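(* Let $\mathcal H$ be a real Hilbert space, $\gamma>0$, $\beta\ge 0$. Let $f\in C^1(\mathcal H)$ be real-valued with $\nabla f$ Lipschitz continuous on bounded subsets of $\mathcal H$ and $\inf_{\mathcal H}f>-\infty$. Let $\phi:\mathcal H\to\mathbb R\cup\{+\infty\}$ be proper, lower semicontinuous and convex with $\phi(0)=\min\phi=0$ and $r\mathbb B\subseteq\partial\phi(0)$ for some $r>0$. Let $x_0\in\mathcal H$, $v_0\in\mathrm{Dom}(\partial\phi)$, and let $(x,v)$, $v=\dot x$, be the global strong solution of $$\ddot x(t)+\gamma\dot x(t)+\partial\phi(\dot x(t))+\nabla f(x(t)+\beta\dot x(t))\ni 0,\quad t\ge0,\qquad x(0)=x_0,\ \dot x(0)=v_0.$$ Set $q(t)=-\nabla f(x(t)+\beta v(t))$ and $T_{\mathrm{stop}}=\inf\{T\ge0:\ v(t)=0\ \text{for every }t\ge T\}$ (with $\inf\varnothing=+\infty$). (a) Suppose there exist $T_0\ge0$ and $\varepsilon>0$ such that $q(t)+\varepsilon\mathbb B\subseteq\partial\phi(0)$ for every $t\ge T_0$. Then the trajectory becomes stationary in finite time. More precisely, for almost every $t\ge T_0$ such that $v(t)\neq0$, $$\frac{d}{dt}\|v(t)\|+\gamma\|v(t)\|+\varepsilon\le0,$$ and consequently $$T_{\mathrm{stop}}\le T_0+\frac1\gamma\log\left(1+\frac{\gamma\|v(T_0)\|}{\varepsilon}\right).$$ (b) If the limit $x_\infty=\lim_{t\to+\infty}x(t)$ satisfies $-\nabla f(x_\infty)\in\mathrm{int}(\partial\phi(0))$,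 then the trajectory becomes stationary in finite time, i.e. $T_{\mathrm{stop}}<+\infty$.
   Context: $\mathbb B$ is the closed unit ball of $\mathcal H$; $\partial\phi$ is the convex subdifferential and $\mathrm{Dom}(\partial\phi)=\{v:\partial\phi(v)\neq\varnothing\}$. A strong solution on $[0,T]$ is a pair $(x,v)$ with $x,v\in W^{1,2}(0,T;\mathcal H)$, $v=\dot x$ a.e., $x(0)=x_0$, $v(0)=v_0$, for which there exists $\xi\in L^2(0,T;\mathcal H)$ with $\xi(t)\in\partial\phi(v(t))$ and $\dot v(t)+\gamma v(t)+\xi(t)+\nabla f(x(t)+\beta v(t))=0$ for a.e. $t\in(0,T)$. A global strong solution is one whose restriction to every $[0,T]$ is a strong solution; under the stated hypotheses it exists and is unique, and $x(t)$ converges strongly as $t\to+\infty$ to a point $x_\infty\in\mathcal H$. *)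

theory Defs
  imports "HOL-Analysis.Analysis"
begin

definition proper_fun :: "('a \<Rightarrow> ereal) \<Rightarrow> bool" where
  "proper_fun \<phi> \<longleftrightarrow> (\<forall>x. \<phi> x \<noteq> -\<infinity>) \<and> (\<exists>x. \<phi> x \<noteq> \<infinity>)"

definition lsc_fun :: "('a::topological_space \<Rightarrow> ereal) \<Rightarrow> bool" where
  "lsc_fun \<phi> \<longleftrightarrow> (\<forall>x. \<phi> x \<le> Liminf (at x) \<phi>)"

definition convex_fun :: "('a::real_vector \<Rightarrow> ereal) \<Rightarrow> bool" where
  "convex_fun \<phi> \<longleftrightarrow> (\<forall>x y t. 0 < t \<longrightarrow> t < 1 \<longrightarrow>
     \<phi> ((1 - t) *\<^sub>R x + t *\<^sub>R y) \<le> ereal (1 - t) * \<phi> x + ereal t * \<phi> y)"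

(* For proper \<phi> this is automatically empty at points where \<phi> v = \<infinity>. *)
definition subdiff :: "('a::real_inner \<Rightarrow> ereal) \<Rightarrow> 'a \<Rightarrow> 'a set" where
  "subdiff \<phi> v = {\<xi>. \<forall>w. \<phi> v + ereal (\<xi> \<bullet> (w - v)) \<le> \<phi> w}"

definition Dom_subdiff :: "('a::real_inner \<Rightarrow> ereal) \<Rightarrow> 'a set" where
  "Dom_subdiff \<phi> = {v. subdiff \<phi> v \<noteq> {}}"

(* Strong (Bochner) measurability: in a space that need not be separable, borel_measurable
   would be too weak. *)
definition strongly_measurable :: "'b measure \<Rightarrow> ('b \<Rightarrow> 'a::topological_space) \<Rightarrow> bool" where
  "strongly_measurable M u \<longleftrightarrow> (\<exists>s. (\<forall>n::nat. simple_function M (s n)) \<and>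
     (AE t in M. (\<lambda>n. s n t) \<longlonglongrightarrow> u t))"

definition L2_fun :: "real \<Rightarrow> (real \<Rightarrow> 'a::real_normed_vector) \<Rightarrow> bool" where
  "L2_fun T u \<longleftrightarrow> strongly_measurable (lebesgue_on {0<..<T}) u \<and>
     (\<integral>\<^sup>+ t. ennreal ((norm (u t))\<^sup>2) \<partial>lebesgue_on {0<..<T}) < \<infinity>"

(* W12_deriv T u g: u is the continuous representative on [0,T] of an element of W^{1,2}(0,T;H)
   with derivative g, i.e. u, g are in L^2 and u(t) = u(0) + int_0^t g for all t in [0,T].
   The library's Bochner integral is restricted to second countable spaces; for g in L^2 the
   Henstock-Kurzweil integral used here agrees with the Bochner integral. *)
definition W12_deriv :: "real \<Rightarrow> (real \<Rightarrow> 'a::real_normed_vector) \<Rightarrow> (real \<Rightarrow> 'a) \<Rightarrow> bool" where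
  "W12_deriv T u g \<longleftrightarrow> L2_fun T u \<and> L2_fun T g \<and>
     (\<forall>t\<in>{0..T}. (g has_integral (u t - u 0)) {0..t})"

(* The argument G is the gradient of f. *)
definition strong_solution ::
  "('a::real_inner \<Rightarrow> ereal) \<Rightarrow> ('a \<Rightarrow> 'a) \<Rightarrow> real \<Rightarrow> real \<Rightarrow> 'a \<Rightarrow> 'a \<Rightarrow> real
     \<Rightarrow> (real \<Rightarrow> 'a) \<Rightarrow> (real \<Rightarrow> 'a) \<Rightarrow> bool" where
  "strong_solution \<phi> G \<gamma> \<beta> x\<^sub>0 v\<^sub>0 T x v \<longleftrightarrow>
     x 0 = x\<^sub>0 \<and> v 0 = v\<^sub>0 \<and>
     (\<exists>x' v' \<xi>. W12_deriv T x x' \<and> W12_deriv T v v' \<and> L2_fun T \<xi> \<and>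
        (AE t in lebesgue_on {0<..<T}. v t = x' t) \<and>
        (AE t in lebesgue_on {0<..<T}. \<xi> t \<in> subdiff \<phi> (v t) \<and>
           v' t + \<gamma> *\<^sub>R v t + \<xi> t + G (x t + \<beta> *\<^sub>R v t) = 0))"

definition global_strong_solution ::
  "('a::real_inner \<Rightarrow> ereal) \<Rightarrow> ('a \<Rightarrow> 'a) \<Rightarrow> real \<Rightarrow> real \<Rightarrow> 'a \<Rightarrow> 'a
     \<Rightarrow> (real \<Rightarrow> 'a) \<Rightarrow> (real \<Rightarrow> 'a) \<Rightarrow> bool" where
  "global_strong_solution \<phi> G \<gamma> \<beta> x\<^sub>0 v\<^sub>0 x v \<longleftrightarrow>
     (\<forall>T>0. strong_solution \<phi> G \<gamma> \<beta> x\<^sub>0 v\<^sub>0 T x v)"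

(* Inf of the empty set is \<infinity> in ereal. *)
definition T_stop :: "(real \<Rightarrow> 'a::zero) \<Rightarrow> ereal" where
  "T_stop v = Inf (ereal ` {T. 0 \<le> T \<and> (\<forall>t\<ge>T. v t = 0)})"

end

theory Submission
  imports Defs
begin

text \<open>The energy comes from pairing the inclusion with \<open>v + \<beta> v'\<close>, the
  derivative of \<open>x + \<beta> v\<close>. The terms in \<open>v \<bullet> v'\<close> add up to
  the coefficient \<open>1 + \<beta> \<gamma>\<close>, the term \<open>\<xi> \<bullet> v'\<close> is
  the formal derivative of \<open>\<phi> (v t)\<close>, and the remaining
  \<open>\<xi> \<bullet> v\<close> is nonnegative because \<open>0\<close> is a subgradient at
  \<open>0\<close>. The obstacle is rigour: \<open>\<phi>\<close> is extended valued and nonsmooth,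
  and the space need not be separable. Instead of a chain rule for \<open>\<phi>\<close>, a
  pointwise bound on left difference quotients of a Lipschitz function controls its increments; this
  is why local Lipschitz continuity of \<open>v\<close> is proved before any energy estimate.
  Differentiability of \<open>x\<close> and \<open>v\<close> almost everywhere is reduced to real
  functions, the distances of the derivative to countably many points. The logarithm is the change
  of variable that turns \<open>n' = - \<gamma> n - \<epsilon>\<close> into motion at constant speed
  \<open>\<gamma>\<close>. For \<open>\<beta> = 0\<close> the force depends on the position alone,
  so convergence of \<open>x\<close> already suffices in the second part.\<close>

text \<open>
  Write \<open>v' = p - \<xi>\<close> with \<open>p = q - \<gamma> v\<close> and \<open>\<xi>\<close> a subgradient at \<open>v\<close>. If \<open>q t\<close> has a margin \<open>\<epsilon>\<close> inside the
  subdifferential at \<open>0\<close>, monotonicity against \<open>q + \<epsilon> v / \<bar>v\<bar>\<close> gives \<open>v \<bullet> v' \<le> - \<gamma> \<bar>v\<bar>\<^sup>2 - \<epsilon> \<bar>v\<bar>\<close>, and the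
  function \<open>ln (1 + \<gamma> \<bar>v\<bar> / \<epsilon>)\<close> decreases at rate \<open>\<gamma>\<close> until \<open>v\<close> vanishes.

  For the second part it remains to see that \<open>v\<close> tends to \<open>0\<close> when \<open>\<beta> > 0\<close>, since then \<open>q\<close> tends to
  the negative gradient at the limit point. The velocity is locally Lipschitz, hence so is \<open>\<phi> (v t)\<close>, and
  the energy \<open>f (x + \<beta> v) + (1 + \<beta> \<gamma>) / 2 \<bar>v\<bar>\<^sup>2 + \<beta> \<phi> (v)\<close> dissipates at least \<open>\<gamma> \<bar>v\<bar>\<^sup>2 + \<beta> \<bar>v'\<bar>\<^sup>2\<close>.
  As it is bounded below, \<open>v\<close> and \<open>v'\<close> are square integrable on the half line.
\<close>

section \<open>Differentiation of the indefinite integral\<close>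

text \<open>The Vitali covering theorem speaks of balls, Henstock's lemma of intervals; this
  translates an interval given by its tag \<open>x\<close> and its other end \<open>u\<close> into a
  ball.\<close>

lemma cball_midpoint_real: "cball ((x + u) / 2) (\<bar>u - x\<bar> / 2) = closed_segment x (u::real)"
proof -
  have "(x + u) / 2 - \<bar>u - x\<bar> / 2 = min x u" "(x + u) / 2 + \<bar>u - x\<bar> / 2 = max x u"
    by (auto simp: min_def max_def abs_if field_simps)
  then show ?thesis
    by (simp add: cball_eq_atLeastAtMost closed_segment_eq_real_ivl min_def max_def)
qed

text \<open>For points where the difference quotient fails by the margin \<open>c\<close>, the offending intervals form a
  Vitali cover; on a disjoint subfamily Henstock's lemma bounds the total failure, hence the total length.\<close>

lemma negligible_not_integral_quotient:
  fixes g :: "real \<Rightarrow> real"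
  assumes g: "g integrable_on {a..b}" and c: "c > 0"
  shows "negligible {x \<in> {a<..<b}. \<forall>d>0. \<exists>u. 0 < \<bar>u - x\<bar> \<and> \<bar>u - x\<bar> < d \<and>
           c * \<bar>u - x\<bar> < \<bar>integral {a..u} g - integral {a..x} g - g x * (u - x)\<bar>}"
    (is "negligible ?B")
  unfolding negligible_outer_le
proof (intro allI impI)
  fix e :: real assume "e > 0"
  \<comment> \<open>On a failing interval the discrepancy exceeds \<open>c\<close> times the length,
    so a total discrepancy below \<open>c * e\<close> leaves total length at most
    \<open>e\<close>.\<close>
  then have "c * e > 0" using c by simp
  obtain \<gamma> where "gauge \<gamma>" and \<gamma>: "\<And>p. \<lbrakk>p tagged_partial_division_of (cbox a b); \<gamma> fine p\<rbrakk> \<Longrightarrow>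
             (\<Sum>(x,k)\<in>p. norm (measure lborel k *\<^sub>R g x - integral k g)) < c * e"
    using Henstock_lemma[OF _ \<open>c * e > 0\<close>, of g a b] g by auto
  define F where "F u = integral {a..u} g" for u
  have Fdiff: "integral {s..t} g = F t - F s" if "a \<le> s" "s \<le> t" "t \<le> b" for s t
    using Henstock_Kurzweil_Integration.integral_combine[of a s t g] that 
      integrable_on_subinterval[OF g, of a t] by (auto simp: F_def)
  \<comment> \<open>A pair \<open>(x, u)\<close> stands for the interval between \<open>x\<close>
    and \<open>u\<close>, tagged at its end \<open>x\<close>. The inclusion in
    \<open>\<gamma> x\<close> makes every finite disjoint subfamily a fine tagged partial
    division.\<close>
  define K where "K = {(x,u). x \<in> {a<..<b} \<and> u \<in> {a<..<b} \<and> u \<noteq> x \<and> closed_segment x u \<subseteq> \<gamma> x \<and>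
      c * \<bar>u - x\<bar> < \<bar>F u - F x - g x * (u - x)\<bar>}"
  let ?ctr = "\<lambda>(x,u). (x + u) / 2 :: real"  and ?rad = "\<lambda>(x,u). \<bar>u - x\<bar> / 2 :: real"
  have cb: "cball (?ctr i) (?rad i) = closed_segment (fst i) (snd i)" for i
    by (cases i) (simp only: prod.case cball_midpoint_real fst_conv snd_conv)
  have rad: "\<And>i. i \<in> K \<Longrightarrow> 0 < ?rad i" by (auto simp: K_def)
  have cover: "\<exists>i. i \<in> K \<and> x \<in> cball (?ctr i) (?rad i) \<and> ?rad i < d"
    if xd: "x \<in> ?B" "0 < d" for x d
  proof -
    have "open (\<gamma> x)" "x \<in> \<gamma> x" using \<open>gauge \<gamma>\<close> by (auto simp: gauge_def)
    then obtain r where "r > 0" and r: "ball x r \<subseteq> \<gamma> x" by (meson openE)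
    have "x \<in> {a<..<b}" using xd by auto
    define d' where "d' = min (min r d) (min (x - a) (b - x))"
    have "d' > 0" using \<open>r > 0\<close> \<open>d > 0\<close> \<open>x \<in> {a<..<b}\<close> by (auto simp: d'_def)
    then obtain u where u: "0 < \<bar>u - x\<bar>" "\<bar>u - x\<bar> < d'"
      "c * \<bar>u - x\<bar> < \<bar>F u - F x - g x * (u - x)\<bar>"
      using xd unfolding F_def by blast
    have "closed_segment x u \<subseteq> ball x r"
      using u by (auto simp: d'_def closed_segment_eq_real_ivl dist_real_def split: if_splits)
    then have "(x,u) \<in> K"
      using u r \<open>x \<in> {a<..<b}\<close> by (auto simp: K_def d'_def abs_if split: if_splits)
    moreover have "?rad (x,u) < d" using u xd(2) by (simp add: d'_def)
    moreover have "x \<in> cball (?ctr (x,u)) (?rad (x,u))" unfolding cb by simp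
    ultimately show ?thesis by blast
  qed
  obtain C where C: "countable C" "C \<subseteq> K"
     "pairwise (\<lambda>i j. disjnt (cball (?ctr i) (?rad i)) (cball (?ctr j) (?rad j))) C"
     and neg: "negligible (?B - (\<Union>i \<in> C. cball (?ctr i) (?rad i)))"
    by (rule Vitali_covering_theorem_cballs[of K ?rad ?B ?ctr, OF rad cover])
  let ?I = "\<lambda>i. closed_segment (fst i) (snd i) :: real set"
  have Ibox: "?I i = cbox (min (fst i) (snd i)) (max (fst i) (snd i))" for i
    by (auto simp: closed_segment_eq_real_ivl)
  have Imeas: "measure lebesgue (?I i) = \<bar>snd i - fst i\<bar>" for i
    unfolding Ibox by (auto simp: min_def max_def)
  have bound: "(\<Sum>i\<in>C'. measure lebesgue (?I i)) \<le> e" if C': "C' \<subseteq> C" "finite C'" for C'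
  proof -
    define p where "p = (\<lambda>i. (fst i, ?I i)) ` C'"
    have inj: "inj_on (\<lambda>i. (fst i, ?I i)) C'"
    proof (rule inj_onI)
      fix i j assume ij: "i \<in> C'" "j \<in> C'" "(fst i, ?I i) = (fst j, ?I j)"
      show "i = j"
      proof (rule ccontr)
        assume "i \<noteq> j"
        then have "disjnt (?I i) (?I j)" using C(3) C'(1) ij unfolding cb pairwise_def by blast
        then show False using ij by (auto simp: disjnt_def)
      qed
    qed
    have "p tagged_partial_division_of cbox a b"
      unfolding tagged_partial_division_of_def
    proof (intro conjI allI impI)
      show "finite p" using C' by (simp add: p_def)
      fix x k assume "(x, k) \<in> p"
      then obtain i where i: "i \<in> C'" "x = fst i" "k = ?I i" by (auto simp: p_def)
      then have "i \<in> K" using C C' by auto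
      then show "x \<in> k" "k \<subseteq> cbox a b"
        using i by (auto simp: K_def closed_segment_eq_real_ivl split: if_splits)
      show "\<exists>a b. k = cbox a b" using Ibox i by metis
    next
      fix x1 k1 x2 k2 assume A: "(x1, k1) \<in> p \<and> (x2, k2) \<in> p \<and> (x1, k1) \<noteq> (x2, k2)"
      then obtain i j where ij: "i \<in> C'" "j \<in> C'" "k1 = ?I i" "k2 = ?I j" "i \<noteq> j"
        by (auto simp: p_def)
      then have "disjnt (?I i) (?I j)" using C(3) C'(1) unfolding cb pairwise_def by blast
      then have "k1 \<inter> k2 = {}" using ij by (simp add: disjnt_def)
      then show "interior k1 \<inter> interior k2 = {}"
        using interior_subset[of k1] interior_subset[of k2] by blast
    qed
    moreover have "\<gamma> fine p"
    proof -
      have "k \<subseteq> \<gamma> x" if xk: "(x, k) \<in> p" for x k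
      proof -
        obtain i where i: "i \<in> C'" "x = fst i" "k = ?I i" using xk by (auto simp: p_def)
        then have "i \<in> K" using C C' by auto
        then show ?thesis using i by (cases i) (simp add: K_def)
      qed
      then show ?thesis by (auto simp: fine_def)
    qed
    ultimately have le: "(\<Sum>(x,k)\<in>p. norm (measure lborel k *\<^sub>R g x - integral k g)) < c * e" by (rule \<gamma>)
    have "c * (\<Sum>i\<in>C'. measure lebesgue (?I i)) = (\<Sum>i\<in>C'. c * \<bar>snd i - fst i\<bar>)"
      by (simp only: Imeas sum_distrib_left)
    also have "\<dots> \<le> (\<Sum>i\<in>C'. norm (measure lborel (?I i) *\<^sub>R g (fst i) - integral (?I i) g))"
    proof (rule sum_mono)
      fix i assume "i \<in> C'"
      then have "i \<in> K" using C C' by auto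
      then obtain x u where i: "i = (x,u)" and x: "x \<in> {a<..<b}" and u: "u \<in> {a<..<b}" "u \<noteq> x"
        and cl: "c * \<bar>u - x\<bar> < \<bar>F u - F x - g x * (u - x)\<bar>" by (auto simp: K_def)
      have "norm (measure lborel (?I i) *\<^sub>R g (fst i) - integral (?I i) g) = \<bar>F u - F x - g x * (u - x)\<bar>"
        using x u Fdiff[of x u] Fdiff[of u x] unfolding i
        by (cases "x \<le> u") (auto simp: closed_segment_eq_real_ivl algebra_simps abs_if)
      then show "c * \<bar>snd i - fst i\<bar> \<le> norm (measure lborel (?I i) *\<^sub>R g (fst i) - integral (?I i) g)"
        using cl i by simp
    qed
    also have "\<dots> = (\<Sum>(x,k)\<in>p. norm (measure lborel k *\<^sub>R g x - integral k g))"
      unfolding p_def by (subst sum.reindex[OF inj]) simp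
    also have "\<dots> < c * e" by (rule le)
    finally show ?thesis using c by simp
  qed
  have U: "(\<Union>i\<in>C. ?I i) \<in> lmeasurable" "measure lebesgue (\<Union>i\<in>C. ?I i) \<le> e"
  proof -
    have m: "?I i \<in> lmeasurable" for i unfolding Ibox by (rule lmeasurable_cbox)
    have "measure lebesgue (\<Union>i\<in>C'. ?I i) \<le> e" if "C' \<subseteq> C" "finite C'" for C'
      using measure_UNION_le[OF that(2), of ?I lebesgue] bound[OF that] m by force
    then show "(\<Union>i\<in>C. ?I i) \<in> lmeasurable" "measure lebesgue (\<Union>i\<in>C. ?I i) \<le> e"
      using fmeasurable_UN_bound[OF C(1), of ?I lebesgue e] measure_UN_bound[OF C(1), of ?I lebesgue e] m by auto
  qed
  show "\<exists>T. ?B \<subseteq> T \<and> T \<in> lmeasurable \<and> measure lebesgue T \<le> e"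
  proof (intro exI conjI)
    let ?N = "?B - (\<Union>i \<in> C. ?I i)"
    have N: "negligible ?N" using neg unfolding cb .
    show "?B \<subseteq> (\<Union>i \<in> C. ?I i) \<union> ?N" by blast
    show "(\<Union>i \<in> C. ?I i) \<union> ?N \<in> lmeasurable" using U N negligible_imp_measurable by blast
    show "measure lebesgue ((\<Union>i \<in> C. ?I i) \<union> ?N) \<le> e"
      using measure_Un_le[of "\<Union>i \<in> C. ?I i" lebesgue ?N] U N 
        negligible_imp_measure0[OF N] negligible_imp_sets[OF N] by (auto simp: fmeasurableD)
  qed
qed

text \<open>If \<open>g x\<close> is not the derivative, the quotient fails by some margin
  \<open>1 / (n + 1)\<close> arbitrarily close to \<open>x\<close>; so the bad set lies in a
  countable union of sets from the preceding lemma.\<close>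

lemma negligible_not_integral_derivative:
  fixes g :: "real \<Rightarrow> real"
  assumes g: "g integrable_on {a..b}"
  shows "negligible {x \<in> {a<..<b}. \<not> ((\<lambda>u. integral {a..u} g) has_real_derivative g x) (at x)}"
proof -
  define B where "B n = {x \<in> {a<..<b}. \<forall>d>0. \<exists>u. 0 < \<bar>u - x\<bar> \<and> \<bar>u - x\<bar> < d \<and>
     inverse (real (Suc n)) * \<bar>u - x\<bar> < \<bar>integral {a..u} g - integral {a..x} g - g x * (u - x)\<bar>}" for n
  have "negligible (\<Union>n. B n)"
    unfolding B_def by (intro negligible_Union_nat negligible_not_integral_quotient[OF g]) simp
  moreover have "((\<lambda>u. integral {a..u} g) has_real_derivative g x) (at x)"
    if x: "x \<in> {a<..<b}" "x \<notin> (\<Union>n. B n)" for x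
    unfolding has_field_derivative_def has_derivative_at_alt
  proof (intro conjI allI impI)
    show "bounded_linear ((*) (g x))" by (rule bounded_linear_mult_right)
    fix e :: real assume "e > 0"
    then obtain n where n: "inverse (real (Suc n)) < e" using reals_Archimedean by blast
    have "x \<notin> B n" using x by auto
    then obtain d where d: "d > 0" "\<And>u. 0 < \<bar>u - x\<bar> \<Longrightarrow> \<bar>u - x\<bar> < d \<Longrightarrow>
      \<bar>integral {a..u} g - integral {a..x} g - g x * (u - x)\<bar> \<le> inverse (real (Suc n)) * \<bar>u - x\<bar>"
      using x(1) unfolding B_def by force
    show "\<exists>d>0. \<forall>u. norm (u - x) < d \<longrightarrow>
      norm (integral {a..u} g - integral {a..x} g - g x * (u - x)) \<le> e * norm (u - x)"
    proof (intro exI conjI allI impI)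
      fix u assume u: "norm (u - x) < d"
      show "norm (integral {a..u} g - integral {a..x} g - g x * (u - x)) \<le> e * norm (u - x)"
      proof (cases "u = x")
        case False
        then have "\<bar>integral {a..u} g - integral {a..x} g - g x * (u - x)\<bar> \<le> inverse (real (Suc n)) * \<bar>u - x\<bar>"
          using d u by simp
        also have "\<dots> \<le> e * \<bar>u - x\<bar>" using n by (intro mult_right_mono) auto
        finally show ?thesis by simp
      qed simp
    qed (rule d)
  qed
  ultimately show ?thesis by (blast intro: negligible_subset)
qed

section \<open>Weak primitives\<close>

text \<open>Overwriting \<open>f\<close> by \<open>k\<close> on \<open>N\<close> keeps its integral
  and makes the comparison hold everywhere.\<close>

lemma integral_le_off_negligible:
  fixes f :: "real \<Rightarrow> real"
  assumes f: "(f has_integral i) S" and k: "k integrable_on S" and N: "negligible N"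
    and le: "\<And>x. x \<in> S - N \<Longrightarrow> f x \<le> k x"
  shows "i \<le> integral S k"
proof -
  have "((\<lambda>x. if x \<in> N then k x else f x) has_integral i) S"
    by (rule has_integral_spike[OF N _ f]) simp
  then show ?thesis
    by (rule has_integral_le[OF _ integrable_integral[OF k]]) (use le in auto)
qed

text \<open>Intended for estimates whose error is under control only on intervals of uniformly small
  length: a chain of equal steps shorter than \<open>\<delta>\<close> joins \<open>a\<close> to
  \<open>b\<close>.\<close>

lemma uniformly_local_antimono:
  fixes F :: "real \<Rightarrow> real"
  assumes "\<delta> > 0" and le: "\<And>s t. a \<le> s \<Longrightarrow> s \<le> t \<Longrightarrow> t \<le> b \<Longrightarrow> t - s < \<delta> \<Longrightarrow> F t \<le> F s"
    and "a \<le> b"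
  shows "F b \<le> F a"
proof -
  obtain n where n: "(b - a) / \<delta> < real n" using reals_Archimedean2 by blast
  then have "n > 0" using \<open>a \<le> b\<close> \<open>\<delta> > 0\<close> by (cases n) (auto simp: field_simps)
  define p where "p i = a + (b - a) / n * real i" for i :: nat
  have step: "(b - a) / n < \<delta>" using n \<open>n > 0\<close> \<open>\<delta> > 0\<close> by (simp add: field_simps)
  have pb: "p i \<le> b" if "i \<le> n" for i
  proof -
    have "(b - a) / n * real i \<le> (b - a) / n * real n"
      using that \<open>a \<le> b\<close> by (intro mult_left_mono) auto
    then show ?thesis using \<open>n > 0\<close> by (simp add: p_def)
  qed
  have "i \<le> n \<Longrightarrow> F (p i) \<le> F a" for i
  proof (induction i)
    case 0 then show ?case by (simp add: p_def)
  next
    case (Suc i)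
    have "p (Suc i) - p i = (b - a) / n" by (simp add: p_def distrib_left)
    moreover have "a \<le> p i" using \<open>a \<le> b\<close> by (simp add: p_def)
    moreover have "(b - a) / n \<ge> 0" using \<open>a \<le> b\<close> by simp
    ultimately have "F (p (Suc i)) \<le> F (p i)"
      using Suc.prems pb step by (intro le) auto
    then show ?case using Suc by simp
  qed
  from this[of n] show ?thesis using \<open>n > 0\<close> by (simp add: p_def)
qed

text \<open>The ambient space below has sorts \<open>real_inner\<close> and \<open>complete_space\<close> but not \<open>banach\<close>, so the
  library's subinterval and norm-bound results for vector-valued integrals do not apply; only the
  scalar integrals of \<open>m \<bullet> w'\<close> are used.\<close>

definition weak_primitive ::
    "real \<Rightarrow> real \<Rightarrow> (real \<Rightarrow> 'a::real_inner) \<Rightarrow> (real \<Rightarrow> 'a) \<Rightarrow> (real \<Rightarrow> real) \<Rightarrow> bool" where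
  "weak_primitive a b w w' \<psi> \<longleftrightarrow>
     (\<forall>m s t. a \<le> s \<longrightarrow> s \<le> t \<longrightarrow> t \<le> b \<longrightarrow> ((\<lambda>\<tau>. m \<bullet> w' \<tau>) has_integral m \<bullet> (w t - w s)) {s..t}) \<and>
     \<psi> integrable_on {a..b} \<and> (\<forall>\<tau>\<in>{a..b}. norm (w' \<tau>) \<le> \<psi> \<tau>)"

lemma weak_primitiveD:
  assumes "weak_primitive a b w w' \<psi>"
  shows "a \<le> s \<Longrightarrow> s \<le> t \<Longrightarrow> t \<le> b \<Longrightarrow> ((\<lambda>\<tau>. m \<bullet> w' \<tau>) has_integral m \<bullet> (w t - w s)) {s..t}"
    and "\<psi> integrable_on {a..b}"
    and "\<tau> \<in> {a..b} \<Longrightarrow> norm (w' \<tau>) \<le> \<psi> \<tau>"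
  using assms by (auto simp: weak_primitive_def)

lemma weak_primitive_integrable_bound:
  assumes "weak_primitive a b w w' \<psi>" "a \<le> s" "t \<le> b"
  shows "\<psi> integrable_on {s..t}"
  using integrable_on_subinterval[OF weak_primitiveD(2)[OF assms(1)], of s t] assms(2,3) by auto

lemma weak_primitive_subinterval:
  assumes "weak_primitive a b w w' \<psi>" "a \<le> c" "d \<le> b"
  shows "weak_primitive c d w w' \<psi>"
  using assms weak_primitive_integrable_bound[OF assms] by (auto simp: weak_primitive_def)

lemma weak_primitive_diff_const:
  assumes "weak_primitive a b w w' \<psi>"
  shows "weak_primitive a b (\<lambda>t. w t - c) w' \<psi>"
  using assms by (simp add: weak_primitive_def)

lemma weak_primitive_diff:
  assumes "weak_primitive a b w w' \<psi>" "weak_primitive a b z z' \<theta>"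
  shows "weak_primitive a b (\<lambda>t. w t - z t) (\<lambda>t. w' t - z' t) (\<lambda>t. \<psi> t + \<theta> t)"
  unfolding weak_primitive_def
proof (intro conjI allI impI ballI)
  fix m s t assume "a \<le> s" "s \<le> t" "t \<le> b"
  then have "((\<lambda>\<tau>. m \<bullet> w' \<tau> - m \<bullet> z' \<tau>) has_integral m \<bullet> (w t - w s) - m \<bullet> (z t - z s)) {s..t}"
    using assms by (intro has_integral_diff weak_primitiveD(1)[of a b])
  moreover have "m \<bullet> (w t - w s) - m \<bullet> (z t - z s) = m \<bullet> (w t - z t - (w s - z s))"
    by (simp add: inner_diff_right)
  ultimately show "((\<lambda>\<tau>. m \<bullet> (w' \<tau> - z' \<tau>)) has_integral m \<bullet> (w t - z t - (w s - z s))) {s..t}"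
    by (simp only: inner_diff_right)
next
  show "(\<lambda>t. \<psi> t + \<theta> t) integrable_on {a..b}"
    using assms by (intro integrable_add weak_primitiveD(2))
next
  fix \<tau> assume "\<tau> \<in> {a..b}"
  then show "norm (w' \<tau> - z' \<tau>) \<le> \<psi> \<tau> + \<theta> \<tau>"
    by (intro norm_triangle_le_diff add_mono weak_primitiveD(3)[OF assms(1)] weak_primitiveD(3)[OF assms(2)])
qed

lemma weak_primitive_translate:
  assumes w: "weak_primitive (a + h) (b + h) w w' \<psi>"
  shows "weak_primitive a b (\<lambda>t. w (t + h)) (\<lambda>t. w' (t + h)) (\<lambda>t. \<psi> (t + h))"
  unfolding weak_primitive_def
proof (intro conjI allI impI ballI)
  show "((\<lambda>\<tau>. m \<bullet> w' (\<tau> + h)) has_integral m \<bullet> (w (t + h) - w (s + h))) {s..t}"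
    if "a \<le> s" "s \<le> t" "t \<le> b" for m s t
    using has_integral_shift_Icc_real[of "\<lambda>\<tau>. m \<bullet> w' \<tau>" h _ s t]
      weak_primitiveD(1)[OF w, of "s + h" "t + h" m] that by (simp add: o_def add.commute)
  show "(\<lambda>t. \<psi> (t + h)) integrable_on {a..b}"
    using integrable_on_shift_Icc_real[of \<psi> h a b] weak_primitiveD(2)[OF w]
    by (simp add: o_def add.commute)
  show "norm (w' (\<tau> + h)) \<le> \<psi> (\<tau> + h)" if "\<tau> \<in> {a..b}" for \<tau>
    using that by (intro weak_primitiveD(3)[OF w]) auto
qed

text \<open>Pairing with the very vector \<open>?m\<close> to be estimated gives
  \<open>\<bar>?m\<bar>\<^sup>2 \<le> \<bar>?m\<bar> * integral {s..t} \<eta>\<close>, and one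
  factor cancels. With \<open>y = 0\<close> this yields continuity, with \<open>y\<close> close to a
  value of \<open>w'\<close> it yields differentiability.\<close>

lemma weak_primitive_norm_diff_le:
  assumes w: "weak_primitive a b w w' \<psi>" and st: "a \<le> s" "s \<le> t" "t \<le> b"
    and \<eta>: "\<eta> integrable_on {s..t}" and N: "negligible N"
    and le: "\<And>\<tau>. \<tau> \<in> {s..t} - N \<Longrightarrow> norm (w' \<tau> - y) \<le> \<eta> \<tau>"
  shows "norm (w t - w s - (t - s) *\<^sub>R y) \<le> integral {s..t} \<eta>"
proof -
  let ?m = "w t - w s - (t - s) *\<^sub>R y"
  have "((\<lambda>\<tau>. ?m \<bullet> w' \<tau> - ?m \<bullet> y) has_integral ?m \<bullet> (w t - w s) - (t - s) * (?m \<bullet> y)) {s..t}"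
    using has_integral_const_real[of "?m \<bullet> y" s t] st
    by (intro has_integral_diff weak_primitiveD(1)[OF w st]) simp
  moreover have "?m \<bullet> (w t - w s) - (t - s) * (?m \<bullet> y) = ?m \<bullet> ?m"
    by (simp add: inner_diff_right)
  ultimately have "((\<lambda>\<tau>. ?m \<bullet> (w' \<tau> - y)) has_integral ?m \<bullet> ?m) {s..t}"
    by (simp only: inner_diff_right)
  then have "?m \<bullet> ?m \<le> integral {s..t} (\<lambda>\<tau>. norm ?m * \<eta> \<tau>)"
  proof (rule integral_le_off_negligible[OF _ _ N])
    show "(\<lambda>\<tau>. norm ?m * \<eta> \<tau>) integrable_on {s..t}" using \<eta> by (rule integrable_on_mult_right)
    show "?m \<bullet> (w' \<tau> - y) \<le> norm ?m * \<eta> \<tau>" if "\<tau> \<in> {s..t} - N" for \<tau>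
      using norm_cauchy_schwarz[of ?m "w' \<tau> - y"] mult_left_mono[OF le[OF that] norm_ge_zero, of ?m] by linarith
  qed
  then have *: "norm ?m * norm ?m \<le> norm ?m * integral {s..t} \<eta>"
    by (simp add: power2_norm_eq_inner[symmetric] power2_eq_square)
  show ?thesis
  proof (cases "?m = 0")
    case True
    have "(0::real) \<le> integral {s..t} \<eta>"
      by (rule integral_le_off_negligible[OF has_integral_0 \<eta> N]) (use le norm_ge_zero order_trans in blast)
    then show ?thesis using True by simp
  next
    case False
    then show ?thesis using * by (metis mult_le_cancel_left_pos zero_less_norm_iff)
  qed
qed

text \<open>Increments of \<open>w\<close> are dominated by those of the indefinite integral of
  \<open>\<psi>\<close>, so \<open>w\<close> inherits its continuity.\<close>

lemma weak_primitive_continuous_on: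
  assumes w: "weak_primitive a b w w' \<psi>"
  shows "continuous_on {a..b} w"
proof -
  let ?I = "\<lambda>t. integral {a..t} \<psi>"
  have c: "continuous_on {a..b} ?I"
    using weak_primitiveD(2)[OF w] by (rule indefinite_integral_continuous_1)
  have 1: "norm (w t - w s) \<le> \<bar>?I t - ?I s\<bar>" if st: "a \<le> s" "s \<le> t" "t \<le> b" for s t
  proof -
    have "norm (w t - w s - (t - s) *\<^sub>R 0) \<le> integral {s..t} \<psi>"
      by (rule weak_primitive_norm_diff_le[OF w st _ negligible_empty])
        (use st weak_primitiveD[OF w] weak_primitive_integrable_bound[OF w] in auto)
    moreover have "integral {s..t} \<psi> = ?I t - ?I s"
      using Henstock_Kurzweil_Integration.integral_combine[of a s t \<psi>] st
        weak_primitive_integrable_bound[OF w, of a t] by auto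
    ultimately show ?thesis by simp
  qed
  then have 2: "dist (w t) (w s) \<le> dist (?I t) (?I s)" if "s \<in> {a..b}" "t \<in> {a..b}" for s t
    using that 1[of s t] 1[of t s] by (cases "s \<le> t") (auto simp: dist_norm norm_minus_commute abs_minus_commute)
  show ?thesis unfolding continuous_on_iff
    using c 2 unfolding continuous_on_iff by (meson le_less_trans)
qed

text \<open>\<open>\<bar>w t\<bar>\<^sup>2 - \<bar>w s\<bar>\<^sup>2\<close> is the pairing of \<open>w t - w s\<close> with \<open>w t + w s\<close>, which is uniformly close to
  \<open>2 w \<tau>\<close> on short intervals; no differentiability of \<open>w\<close> is needed.\<close>

lemma weak_primitive_norm_square_le:
  assumes w: "weak_primitive a b w w' \<psi>" and k: "k integrable_on {a..b}" and N: "negligible N"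
    and le: "\<And>\<tau>. \<tau> \<in> {a..b} - N \<Longrightarrow> w \<tau> \<bullet> w' \<tau> \<le> k \<tau>" and "a \<le> b"
  shows "(norm (w b))\<^sup>2 - (norm (w a))\<^sup>2 \<le> 2 * integral {a..b} k"
proof -
  have "(norm (w b))\<^sup>2 / 2 - (norm (w a))\<^sup>2 / 2 - integral {a..b} k \<le> e * integral {a..b} \<psi>" if "e > 0" for e
  proof -
    have "uniformly_continuous_on {a..b} w"
      by (rule compact_uniformly_continuous[OF weak_primitive_continuous_on[OF w] compact_Icc])
    then obtain \<delta> where "\<delta> > 0" and
      \<delta>: "\<And>x y. x \<in> {a..b} \<Longrightarrow> y \<in> {a..b} \<Longrightarrow> dist y x < \<delta> \<Longrightarrow> dist (w y) (w x) < e"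
      unfolding uniformly_continuous_on_def using \<open>e > 0\<close> by metis
    \<comment> \<open>The extra \<open>e * \<psi>\<close> pays for replacing \<open>w \<tau>\<close>
      by the mean of the two end values, which is within \<open>e\<close> of it on intervals shorter
      than \<open>\<delta>\<close>. Thus \<open>F\<close> decreases over short intervals, and
      \<open>e\<close> is sent to \<open>0\<close> at the end.\<close>
    define F where "F t = (norm (w t))\<^sup>2 / 2 - integral {a..t} (\<lambda>\<tau>. k \<tau> + e * \<psi> \<tau>)" for t
    have ki: "(\<lambda>\<tau>. k \<tau> + e * \<psi> \<tau>) integrable_on {a..b}"
      by (intro integrable_add k integrable_on_mult_right weak_primitiveD(2)[OF w])
    have "F t \<le> F s" if st: "a \<le> s" "s \<le> t" "t \<le> b" and "t - s < \<delta>" for s t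
    proof -
      let ?m = "(1/2) *\<^sub>R (w t + w s)"
      have "(norm (w t))\<^sup>2 / 2 - (norm (w s))\<^sup>2 / 2 = ?m \<bullet> (w t - w s)"
        by (simp add: power2_norm_eq_inner inner_diff_left inner_diff_right inner_add_left inner_add_right inner_commute)
      also have "\<dots> \<le> integral {s..t} (\<lambda>\<tau>. k \<tau> + e * \<psi> \<tau>)"
      proof (rule integral_le_off_negligible[OF weak_primitiveD(1)[OF w st] _ N])
        show "(\<lambda>\<tau>. k \<tau> + e * \<psi> \<tau>) integrable_on {s..t}"
          using integrable_on_subinterval[OF ki, of s t] st by auto
        fix \<tau> assume \<tau>: "\<tau> \<in> {s..t} - N"
        then have "\<tau> \<in> {a..b} - N" using st by auto
        have "norm (?m - w \<tau>) \<le> e"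
        proof -
          have "?m - w \<tau> = (1/2) *\<^sub>R ((w t - w \<tau>) + (w s - w \<tau>))"
            by (simp add: algebra_simps flip: scaleR_add_left)
          then have "norm (?m - w \<tau>) = norm ((w t - w \<tau>) + (w s - w \<tau>)) / 2" by simp
          also have "\<dots> \<le> (norm (w t - w \<tau>) + norm (w s - w \<tau>)) / 2"
            using norm_triangle_ineq by (intro divide_right_mono) auto
          finally show ?thesis
            using \<delta>[of \<tau> t] \<delta>[of \<tau> s] \<tau> st \<open>t - s < \<delta>\<close> by (auto simp: dist_norm)
        qed
        then have "(?m - w \<tau>) \<bullet> w' \<tau> \<le> e * \<psi> \<tau>"
          using norm_cauchy_schwarz[of "?m - w \<tau>" "w' \<tau>"] weak_primitiveD(3)[OF w, of \<tau>] \<open>e > 0\<close>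
            mult_mono[of "norm (?m - w \<tau>)" e "norm (w' \<tau>)" "\<psi> \<tau>"] \<tau> st by auto
        moreover have "?m \<bullet> w' \<tau> = w \<tau> \<bullet> w' \<tau> + (?m - w \<tau>) \<bullet> w' \<tau>" by (simp add: inner_diff_left)
        ultimately show "?m \<bullet> w' \<tau> \<le> k \<tau> + e * \<psi> \<tau>" using le[OF \<open>\<tau> \<in> {a..b} - N\<close>] by linarith
      qed
      finally show ?thesis
        using Henstock_Kurzweil_Integration.integral_combine[of a s t "\<lambda>\<tau>. k \<tau> + e * \<psi> \<tau>"] st
          integrable_on_subinterval[OF ki, of a t] by (auto simp: F_def)
    qed
    then have "F b \<le> F a" by (intro uniformly_local_antimono[OF \<open>\<delta> > 0\<close> _ \<open>a \<le> b\<close>]) auto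
    moreover have "integral {a..b} (\<lambda>\<tau>. k \<tau> + e * \<psi> \<tau>) = integral {a..b} k + e * integral {a..b} \<psi>"
      using integral_add[OF k integrable_on_mult_right[OF weak_primitiveD(2)[OF w]]] by simp
    ultimately show ?thesis by (simp add: F_def)
  qed
  moreover have "((\<lambda>e. e * integral {a..b} \<psi>) \<longlongrightarrow> 0 * integral {a..b} \<psi>) (at_right 0)"
    by (intro tendsto_intros)
  ultimately have "(norm (w b))\<^sup>2 / 2 - (norm (w a))\<^sup>2 / 2 - integral {a..b} k \<le> 0 * integral {a..b} \<psi>"
    by (intro tendsto_lowerbound[of _ _ "at_right 0"]) (auto simp: eventually_at_filter)
  then show ?thesis by simp
qed

section \<open>Sobolev functions on an interval\<close>

lemma AE_lebesgue_on_iff_negligible: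
  assumes "S \<in> sets lebesgue"
  shows "(AE t in lebesgue_on S. P t) \<longleftrightarrow> (\<exists>N. negligible N \<and> (\<forall>t\<in>S - N. P t))"
proof -
  have "(AE t in lebesgue_on S. P t) \<longleftrightarrow> (AE t in lebesgue. t \<in> S \<longrightarrow> P t)"
    by (rule AE_restrict_space_iff) (use assms in auto)
  also have "\<dots> \<longleftrightarrow> (\<exists>N. negligible N \<and> (\<forall>t\<in>S - N. P t))"
    unfolding eventually_ae_filter_negligible by blast
  finally show ?thesis .
qed

text \<open>Norms of simple functions are measurable real functions whatever the topology of the
  space. Their \<open>lim\<close> is measurable everywhere and has the right value wherever the
  simple functions converge, hence the detour through \<open>h\<close>.\<close>

lemma strongly_measurable_norm_diff:
  fixes u :: "'b \<Rightarrow> 'a::real_normed_vector"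
  assumes "strongly_measurable M u"
  obtains h where "h \<in> borel_measurable M" "AE t in M. h t = norm (u t - y)"
proof -
  obtain s where s: "\<And>n::nat. simple_function M (s n)" "AE t in M. (\<lambda>n. s n t) \<longlonglongrightarrow> u t"
    using assms by (auto simp: strongly_measurable_def)
  show thesis
  proof
    show "(\<lambda>t. lim (\<lambda>n. norm (s n t - y))) \<in> borel_measurable M"
    proof (rule borel_measurable_lim_metric)
      show "(\<lambda>t. norm (s n t - y)) \<in> borel_measurable M" for n
        using simple_function_compose[OF s(1)[of n], of "\<lambda>z. norm (z - y)"]
        by (intro borel_measurable_simple_function) (simp add: o_def)
    qed
    show "AE t in M. lim (\<lambda>n. norm (s n t - y)) = norm (u t - y)"
      using s(2) by eventually_elim (intro limI tendsto_intros)
  qed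
qed

lemma integrable_on_Icc_of_AE_eq:
  fixes f g :: "real \<Rightarrow> real"
  assumes "integrable (lebesgue_on {a<..<b}) f" "AE t in lebesgue_on {a<..<b}. f t = g t"
  shows "g integrable_on {a..b}"
proof -
  have "f integrable_on {a<..<b}"
    using assms(1) by (intro integrable_on_lebesgue_on) auto
  moreover obtain N where "negligible N" "\<forall>t\<in>{a<..<b} - N. f t = g t"
    using assms(2) by (auto simp: AE_lebesgue_on_iff_negligible)
  ultimately have "g integrable_on {a<..<b}"
    by (auto intro: integrable_spike)
  then show ?thesis by (simp add: integrable_on_Icc_iff_Ioo)
qed

lemma L2_fun_integrable_on:
  assumes "L2_fun T u"
  shows "(\<lambda>t. (norm (u t))\<^sup>2) integrable_on {0..T}" "(\<lambda>t. norm (u t - y)) integrable_on {0..T}"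
proof -
  let ?M = "lebesgue_on {0<..<T}"
  have sm: "strongly_measurable ?M u" and fin: "(\<integral>\<^sup>+ t. ennreal ((norm (u t))\<^sup>2) \<partial>?M) < \<infinity>"
    using assms by (auto simp: L2_fun_def)
  obtain h where h: "h \<in> borel_measurable ?M" "AE t in ?M. h t = norm (u t - 0)"
    using strongly_measurable_norm_diff[OF sm] by blast
  obtain hy where hy: "hy \<in> borel_measurable ?M" "AE t in ?M. hy t = norm (u t - y)"
    using strongly_measurable_norm_diff[OF sm] by blast
  have AEsq: "AE t in ?M. (h t)\<^sup>2 = (norm (u t))\<^sup>2"
    using h(2) by eventually_elim simp
  have "(\<integral>\<^sup>+ t. ennreal (norm ((h t)\<^sup>2)) \<partial>?M) = (\<integral>\<^sup>+ t. ennreal ((norm (u t))\<^sup>2) \<partial>?M)"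
    using AEsq by (intro nn_integral_cong_AE) (auto elim!: eventually_mono)
  then have hint: "integrable ?M (\<lambda>t. (h t)\<^sup>2)"
    using h(1) fin by (intro integrableI_bounded) auto
  then show "(\<lambda>t. (norm (u t))\<^sup>2) integrable_on {0..T}"
    using AEsq by (rule integrable_on_Icc_of_AE_eq)
  \<comment> \<open>This dominates \<open>norm (u t - y)\<close>: it is at most
    \<open>norm (u t) + norm y\<close>, and
    \<open>2 * norm (u t) \<le> 1 + (norm (u t))\<^sup>2\<close>. Constants are integrable because
    the interval is bounded.\<close>
  have "integrable ?M (\<lambda>t. (1 + norm y) + (h t)\<^sup>2)"
    using lmeasurable_box[of 0 T]
    by (intro Bochner_Integration.integrable_add hint finite_measure.integrable_const
        finite_measure_lebesgue_on) (simp_all add: box_real)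
  then have "integrable ?M hy"
  proof (rule Bochner_Integration.integrable_bound[OF _ hy(1)])
    show "AE t in ?M. norm (hy t) \<le> norm ((1 + norm y) + (h t)\<^sup>2)"
      using hy(2) h(2)
    proof eventually_elim
      case (elim t)
      have "norm (u t - y) \<le> norm (u t) + norm y" by (rule norm_triangle_ineq4)
      moreover have "2 * norm (u t) \<le> 1 + (norm (u t))\<^sup>2"
        using sum_power2_ge_zero[of "norm (u t) - 1" 0] by (simp add: power2_diff)
      ultimately have "norm (u t - y) \<le> (1 + norm y) + (norm (u t))\<^sup>2"
        using norm_ge_zero[of "u t"] by linarith
      then show ?case using elim by simp
    qed
  qed
  then show "(\<lambda>t. norm (u t - y)) integrable_on {0..T}"
    using hy(2) by (rule integrable_on_Icc_of_AE_eq)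
qed

text \<open>Each simple function has finitely many values, so all their values together form a
  countable set whose closure contains almost every limit. It serves as the countable family of test
  points in the differentiation theorem.\<close>

lemma strongly_measurable_separable_range:
  assumes "strongly_measurable M u"
  obtains Y where "countable Y" "AE t in M. u t \<in> closure Y"
proof -
  obtain s where s: "\<And>n::nat. simple_function M (s n)" "AE t in M. (\<lambda>n. s n t) \<longlonglongrightarrow> u t"
    using assms by (auto simp: strongly_measurable_def)
  show thesis
  proof
    show "countable (\<Union>n. s n ` space M)"
      by (intro countable_UN countableI_type countable_finite simple_functionD(1) s(1))
    show "AE t in M. u t \<in> closure (\<Union>n. s n ` space M)"
      using s(2) AE_space
    proof eventually_elim
      case (elim t)
      then have "s n t \<in> closure (\<Union>n. s n ` space M)" for n
        by (intro subsetD[OF closure_subset]) auto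
      then show ?case by (rule closed_sequentially[OF closed_closure _ elim(1)])
    qed
  qed
qed

lemma W12_weak_primitive:
  fixes u g :: "real \<Rightarrow> 'a::real_inner"
  assumes "W12_deriv T u g"
  shows "weak_primitive 0 T u g (\<lambda>t. norm (g t))"
  unfolding weak_primitive_def
proof (intro conjI allI impI ballI order_refl)
  fix m s t assume st: "0 \<le> s" "s \<le> t" "t \<le> T"
  have *: "((\<lambda>\<tau>. m \<bullet> g \<tau>) has_integral m \<bullet> (u r - u 0)) {0..r}" if "r \<in> {0..T}" for r
    using has_integral_linear[OF _ bounded_linear_inner_right[of m], of g "u r - u 0" "{0..r}"] assms that
    by (simp add: W12_deriv_def o_def)
  then have i: "(\<lambda>\<tau>. m \<bullet> g \<tau>) integrable_on {0..t}"
    using has_integral_integrable[OF *[of t]] st by simp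
  then have "(\<lambda>\<tau>. m \<bullet> g \<tau>) integrable_on {s..t}"
    by (rule integrable_on_subinterval) (use st in auto)
  moreover have "integral {s..t} (\<lambda>\<tau>. m \<bullet> g \<tau>) = m \<bullet> (u t - u s)"
    using Henstock_Kurzweil_Integration.integral_combine[OF _ _ i, of s] st
      integral_unique[OF *[of s]] integral_unique[OF *[of t]]
    by (auto simp: inner_diff_right)
  ultimately show "((\<lambda>\<tau>. m \<bullet> g \<tau>) has_integral m \<bullet> (u t - u s)) {s..t}"
    by (metis integrable_integral)
next
  show "(\<lambda>t. norm (g t)) integrable_on {0..T}"
    using L2_fun_integrable_on(2)[of T g 0] assms by (simp add: W12_deriv_def)
qed

text \<open>This is the Lebesgue point argument. For each of countably many \<open>y\<close>, the
  integral \<open>G y\<close> of \<open>norm (g \<tau> - y)\<close> has derivative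
  \<open>norm (g t - y)\<close> off a null set. At a common good \<open>t\<close>, some
  \<open>y\<close> is close to \<open>g t\<close>, and increments of \<open>u\<close> differ from
  \<open>(z - t) *\<^sub>R y\<close> by at most the increment of \<open>G y\<close>.\<close>

lemma W12_has_vector_derivative:
  fixes u g :: "real \<Rightarrow> 'a::real_inner"
  assumes "W12_deriv T u g"
  obtains N where "negligible N" "\<And>t. t \<in> {0<..<T} - N \<Longrightarrow> (u has_vector_derivative g t) (at t)"
proof -
  have g: "L2_fun T g" and sm: "strongly_measurable (lebesgue_on {0<..<T}) g"
    using assms by (auto simp: W12_deriv_def L2_fun_def)
  note wp = W12_weak_primitive[OF assms]
  obtain Y where Y: "countable Y" "AE t in lebesgue_on {0<..<T}. g t \<in> closure Y"
    using strongly_measurable_separable_range[OF sm] .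
  obtain N0 where N0: "negligible N0" "\<forall>t\<in>{0<..<T} - N0. g t \<in> closure Y"
    using Y(2) by (auto simp: AE_lebesgue_on_iff_negligible)
  define G where "G y t = integral {0..t} (\<lambda>\<tau>. norm (g \<tau> - y))" for y t
  define N1 where "N1 y = {t \<in> {0<..<T}. \<not> (G y has_real_derivative norm (g t - y)) (at t)}" for y
  have "negligible (\<Union> (N1 ` Y))"
    using Y(1) negligible_not_integral_derivative[OF L2_fun_integrable_on(2)[OF g]]
    unfolding N1_def G_def by (intro negligible_countable_Union) auto
  then have "negligible (N0 \<union> \<Union> (N1 ` Y))" using N0(1) by simp
  moreover have "(u has_vector_derivative g t) (at t)" if t: "t \<in> {0<..<T} - (N0 \<union> \<Union> (N1 ` Y))" for t
    unfolding has_vector_derivative_def has_derivative_at_alt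
  proof (intro conjI allI impI)
    show "bounded_linear (\<lambda>x. x *\<^sub>R g t)" by (rule bounded_linear_scaleR_left)
    fix e :: real assume "e > 0"
    have "g t \<in> closure Y" using t N0 by auto
    \<comment> \<open>The budget \<open>e\<close> splits into three: the differentiation error of
      \<open>G y\<close>, its derivative \<open>norm (g t - y)\<close>, and the final replacement of
      \<open>y\<close> by \<open>g t\<close>.\<close>
    then obtain y where y: "y \<in> Y" "norm (g t - y) < e / 3"
      using \<open>e > 0\<close> unfolding closure_approachable
      by (metis dist_norm norm_minus_commute zero_less_divide_iff zero_less_numeral)
    have "(G y has_real_derivative norm (g t - y)) (at t)" using t y(1) by (auto simp: N1_def)
    then obtain d where "d > 0" and d: "\<And>z. norm (z - t) < d \<Longrightarrow>
        norm (G y z - G y t - norm (g t - y) * (z - t)) \<le> e / 3 * norm (z - t)"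
      using \<open>e > 0\<close> unfolding has_field_derivative_def has_derivative_at_alt
      by (metis zero_less_divide_iff zero_less_numeral)
    show "\<exists>d>0. \<forall>z. norm (z - t) < d \<longrightarrow> norm (u z - u t - (z - t) *\<^sub>R g t) \<le> e * norm (z - t)"
    proof (intro exI[of _ "min d (min t (T - t))"] conjI allI impI)
      show "0 < min d (min t (T - t))" using \<open>d > 0\<close> t by auto
      fix z assume z: "norm (z - t) < min d (min t (T - t))"
      have Gd: "norm (u q - u p - (q - p) *\<^sub>R y) \<le> G y q - G y p" if "0 \<le> p" "p \<le> q" "q \<le> T" for p q
      proof -
        have i: "(\<lambda>\<tau>. norm (g \<tau> - y)) integrable_on {0..q}"
          by (rule integrable_on_subinterval[OF L2_fun_integrable_on(2)[OF g]]) (use that in auto)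
        have "norm (u q - u p - (q - p) *\<^sub>R y) \<le> integral {p..q} (\<lambda>\<tau>. norm (g \<tau> - y))"
          by (rule weak_primitive_norm_diff_le[OF wp that _ negligible_empty])
            (use that integrable_on_subinterval[OF i] in auto)
        then show ?thesis
          using Henstock_Kurzweil_Integration.integral_combine[OF _ _ i, of p] that
          by (simp add: G_def)
      qed
      have "norm (u z - u t - (z - t) *\<^sub>R y) \<le> \<bar>G y z - G y t\<bar>"
      proof (cases "t \<le> z")
        case True then show ?thesis using Gd[of t z] z t by auto
      next
        case False
        have "norm (u z - u t - (z - t) *\<^sub>R y) = norm (u t - u z - (t - z) *\<^sub>R y)"
          by (subst norm_minus_commute) (simp add: algebra_simps)
        then show ?thesis using Gd[of z t] z t False by auto
      qed
      also have "\<dots> \<le> \<bar>G y z - G y t - norm (g t - y) * (z - t)\<bar> + norm (g t - y) * \<bar>z - t\<bar>"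
        using abs_triangle_ineq[of "G y z - G y t - norm (g t - y) * (z - t)" "norm (g t - y) * (z - t)"]
        by (simp add: abs_mult)
      also have "\<dots> \<le> e / 3 * \<bar>z - t\<bar> + e / 3 * \<bar>z - t\<bar>"
        using d[of z] z y(2) by (intro add_mono mult_right_mono) auto
      finally have 1: "norm (u z - u t - (z - t) *\<^sub>R y) \<le> e / 3 * \<bar>z - t\<bar> + e / 3 * \<bar>z - t\<bar>" .
      have "u z - u t - (z - t) *\<^sub>R g t = (u z - u t - (z - t) *\<^sub>R y) - (z - t) *\<^sub>R (g t - y)"
        by (simp add: algebra_simps)
      then have "norm (u z - u t - (z - t) *\<^sub>R g t) \<le> norm (u z - u t - (z - t) *\<^sub>R y) + \<bar>z - t\<bar> * norm (g t - y)"
        by (metis norm_triangle_ineq4 norm_scaleR)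
      also have "\<dots> \<le> e / 3 * \<bar>z - t\<bar> + e / 3 * \<bar>z - t\<bar> + \<bar>z - t\<bar> * (e / 3)"
        using 1 y(2) by (intro add_mono mult_left_mono) auto
      finally show "norm (u z - u t - (z - t) *\<^sub>R g t) \<le> e * norm (z - t)" by (simp add: algebra_simps)
    qed
  qed
  ultimately show thesis by (rule that)
qed

section \<open>Increments of Lipschitz functions\<close>

text \<open>Averaging the left difference quotients of \<open>E\<close> recovers its increment in the limit, while
  dominated convergence applies to their maximum with \<open>k\<close>.\<close>

lemma lipschitz_increment_le_integral:
  fixes E k :: "real \<Rightarrow> real"
  assumes "a \<le> b" and "K \<ge> 0"
    and lip: "\<And>s t. s \<in> {a..b} \<Longrightarrow> t \<in> {a..b} \<Longrightarrow> \<bar>E t - E s\<bar> \<le> K * \<bar>t - s\<bar>"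
    and k: "k absolutely_integrable_on {a..b}" and N: "negligible N"
    and left: "\<And>t e. t \<in> {a<..<b} - N \<Longrightarrow> e > 0 \<Longrightarrow>
        \<forall>\<^sub>F h in at_right 0. E t - E (t - h) \<le> (k t + e) * h"
  shows "E b - E a \<le> integral {a..b} k"
proof -
  \<comment> \<open>The constant extension beyond \<open>{a..b}\<close> keeps the Lipschitz constant
    and gives meaning to \<open>E (t - h)\<close> when \<open>t - h\<close> falls left of
    \<open>a\<close>.\<close>
  define Eb where "Eb s = E (max a (min b s))" for s
  define h where "h n = inverse (real (Suc n))" for n
  define q where "q n t = (Eb t - Eb (t - h n)) / h n" for n t
  let ?M = "lebesgue_on {a..b}"
  have h: "h n > 0" for n by (simp add: h_def)
  have hlim: "h \<longlonglongrightarrow> 0" unfolding h_def by (rule LIMSEQ_inverse_real_of_nat)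
  have lipb: "\<bar>Eb t - Eb s\<bar> \<le> K * \<bar>t - s\<bar>" for s t
  proof -
    have "\<bar>Eb t - Eb s\<bar> \<le> K * \<bar>max a (min b t) - max a (min b s)\<bar>"
      unfolding Eb_def using \<open>a \<le> b\<close> by (intro lip) auto
    also have "\<dots> \<le> K * \<bar>t - s\<bar>" using \<open>K \<ge> 0\<close> by (intro mult_left_mono) auto
    finally show ?thesis .
  qed
  have "K-lipschitz_on UNIV Eb"
    using lipb \<open>K \<ge> 0\<close> by (intro lipschitz_onI) (auto simp: dist_real_def)
  then have "continuous_on UNIV Eb" by (rule lipschitz_on_continuous_on)
  then have cont: "continuous_on S Eb" for S by (rule continuous_on_subset) simp
  have Ebi: "Eb integrable_on {c..d}" for c d by (rule integrable_continuous_real[OF cont])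
  have cq: "continuous_on {a..b} (q n)" for n
    unfolding q_def using h[of n]
    by (intro continuous_intros cont continuous_on_compose2[OF cont[of UNIV], of _ "\<lambda>t. t - h n"]) auto
  have bq: "\<bar>q n t\<bar> \<le> K" for n t
    using lipb[of t "t - h n"] h[of n] by (simp add: q_def field_simps)
  have ki: "integrable ?M k" using absolutely_integrable_imp_integrable[OF k] by simp
  have Ki: "integrable ?M (\<lambda>t. K)" by (rule continuous_imp_integrable_real) simp
  have mq: "q n \<in> borel_measurable ?M" for n
    by (rule continuous_imp_measurable_on_sets_lebesgue[OF cq]) simp
  have qi: "integrable ?M (q n)" for n
    by (rule Bochner_Integration.integrable_bound[OF Ki mq]) (use bq \<open>K \<ge> 0\<close> in auto)
  \<comment> \<open>The quotients are controlled only from above, so they need not converge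
    themselves; clipping them below by \<open>k t\<close> forces the limit
    \<open>k t\<close>.\<close>
  have "AE t in ?M. (\<lambda>n. max (q n t) (k t)) \<longlonglongrightarrow> k t"
    unfolding AE_lebesgue_on_iff_negligible[of "{a..b}", simplified]
  proof (intro exI[of _ "N \<union> {a, b}"] conjI ballI)
    show "negligible (N \<union> {a, b})" using N by simp
    fix t assume "t \<in> {a..b} - (N \<union> {a, b})"
    then have t: "t \<in> {a<..<b} - N" by auto
    show "(\<lambda>n. max (q n t) (k t)) \<longlonglongrightarrow> k t"
    proof (rule LIMSEQ_I)
      fix e :: real assume "e > 0"
      have "filterlim h (at_right 0) sequentially"
        unfolding filterlim_at using hlim h by (auto intro!: always_eventually simp: order_less_imp_not_eq2)
      moreover have "\<forall>\<^sub>F h in at_right 0. E t - E (t - h) \<le> (k t + e / 2) * h"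
        using left[OF t, of "e / 2"] \<open>e > 0\<close> by simp
      ultimately have "\<forall>\<^sub>F n in sequentially. E t - E (t - h n) \<le> (k t + e / 2) * h n"
        by (rule eventually_compose_filterlim[rotated])
      moreover have "\<forall>\<^sub>F n in sequentially. h n < t - a"
        using hlim t by (intro order_tendstoD) auto
      ultimately have "\<forall>\<^sub>F n in sequentially. norm (max (q n t) (k t) - k t) < e"
      proof eventually_elim
        case (elim n)
        then have "Eb t = E t" "Eb (t - h n) = E (t - h n)"
          using t h[of n] by (auto simp: Eb_def max_def min_def)
        then have "q n t \<le> k t + e / 2" using elim h[of n] by (simp add: q_def field_simps)
        then show ?case using \<open>e > 0\<close> by auto
      qed
      then show "\<exists>no. \<forall>n\<ge>no. norm (max (q n t) (k t) - k t) < e" by (simp add: eventually_sequentially)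
    qed
  qed
  then have "(\<lambda>n. integral\<^sup>L ?M (\<lambda>t. max (q n t) (k t))) \<longlonglongrightarrow> integral\<^sup>L ?M k"
  proof (rule integral_dominated_convergence[where w = "\<lambda>t. K + \<bar>k t\<bar>", rotated 3])
    show "AE t in ?M. norm (max (q n t) (k t)) \<le> K + \<bar>k t\<bar>" for n
    proof (rule AE_I2)
      fix t show "norm (max (q n t) (k t)) \<le> K + \<bar>k t\<bar>"
        using bq[of n t] \<open>K \<ge> 0\<close> by (auto simp: max_def)
    qed
    show "k \<in> borel_measurable ?M" by (rule borel_measurable_integrable[OF ki])
    then show "(\<lambda>t. max (q n t) (k t)) \<in> borel_measurable ?M" for n
      by (intro borel_measurable_max mq)
    show "integrable ?M (\<lambda>t. K + \<bar>k t\<bar>)"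
      by (intro Bochner_Integration.integrable_add Ki integrable_abs ki)
  qed
  moreover have "(\<lambda>n. E b - E a - 2 * K * h n) \<longlonglongrightarrow> E b - E a - 2 * K * 0"
    by (intro tendsto_intros hlim)
  \<comment> \<open>By translation the integral of \<open>q n\<close> is the mean of
    \<open>Eb\<close> over the last window of length \<open>h n\<close> minus the mean over the
    window of that length just before \<open>a\<close>. Each mean is within \<open>K * h n\<close>
    of the end value.\<close>
  moreover have "E b - E a - 2 * K * h n \<le> integral\<^sup>L ?M (\<lambda>t. max (q n t) (k t))" for n
  proof -
    let ?h = "h n"
    have 1: "integral {a..b} (\<lambda>t. Eb (t - ?h)) = integral {a - ?h..b - ?h} Eb"
      using integral_shift_Icc_real[of a b Eb "- ?h"] by (simp add: o_def)
    have 2: "integral {a - ?h..b - ?h} Eb + integral {b - ?h..b} Eb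
        = integral {a - ?h..a} Eb + integral {a..b} Eb"
      using Henstock_Kurzweil_Integration.integral_combine[of "a - ?h" "b - ?h" b Eb] Ebi
        Henstock_Kurzweil_Integration.integral_combine[of "a - ?h" a b Eb] h[of n] \<open>a \<le> b\<close> by simp
    have "integral {b - ?h..b} (\<lambda>t. E b - K * ?h) \<le> integral {b - ?h..b} Eb"
    proof (rule integral_le[OF integrable_const_ivl Ebi])
      fix t assume "t \<in> {b - ?h..b}"
      then have "\<bar>Eb t - Eb b\<bar> \<le> K * ?h"
        using lipb[of t b] mult_left_mono[of "\<bar>t - b\<bar>" ?h K] \<open>K \<ge> 0\<close> by auto
      moreover have "Eb b = E b" using \<open>a \<le> b\<close> by (simp add: Eb_def)
      ultimately show "E b - K * ?h \<le> Eb t" by linarith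
    qed
    then have 3: "(E b - K * ?h) * ?h \<le> integral {b - ?h..b} Eb" using h[of n] by (simp add: mult.commute)
    have "integral {a - ?h..a} Eb \<le> integral {a - ?h..a} (\<lambda>t. E a + K * ?h)"
    proof (rule integral_le[OF Ebi integrable_const_ivl])
      fix t assume "t \<in> {a - ?h..a}"
      then have "\<bar>Eb t - Eb a\<bar> \<le> K * ?h"
        using lipb[of t a] mult_left_mono[of "\<bar>t - a\<bar>" ?h K] \<open>K \<ge> 0\<close> by auto
      moreover have "Eb a = E a" using \<open>a \<le> b\<close> by (simp add: Eb_def)
      ultimately show "Eb t \<le> E a + K * ?h" by linarith
    qed
    then have 4: "integral {a - ?h..a} Eb \<le> (E a + K * ?h) * ?h" using h[of n] by (simp add: mult.commute)
    have "integral {a..b} (q n) = (integral {a..b} Eb - integral {a..b} (\<lambda>t. Eb (t - ?h))) / ?h"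
    proof -
      have "(\<lambda>t. Eb (t - ?h)) integrable_on {a..b}"
        by (intro integrable_continuous_real continuous_on_compose2[OF cont[of UNIV]] continuous_intros) auto
      then show ?thesis unfolding q_def using Ebi by (simp add: integral_diff)
    qed
    also have "\<dots> = (integral {b - ?h..b} Eb - integral {a - ?h..a} Eb) / ?h"
      using 1 2 by (simp add: algebra_simps)
    also have "\<dots> \<ge> ((E b - K * ?h) * ?h - (E a + K * ?h) * ?h) / ?h"
      using 3 4 h[of n] by (intro divide_right_mono) auto
    also have "((E b - K * ?h) * ?h - (E a + K * ?h) * ?h) / ?h = E b - E a - 2 * K * ?h"
      using h[of n] by (simp add: field_simps)
    finally have "E b - E a - 2 * K * ?h \<le> integral {a..b} (q n)" .
    also have "\<dots> = integral\<^sup>L ?M (q n)"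
      using lebesgue_integral_eq_integral[OF qi] by simp
    also have "\<dots> \<le> integral\<^sup>L ?M (\<lambda>t. max (q n t) (k t))"
      using qi ki by (intro integral_mono) auto
    finally show ?thesis .
  qed
  ultimately have "E b - E a - 2 * K * 0 \<le> integral\<^sup>L ?M k"
    by (intro LIMSEQ_le[of _ _ _ "integral\<^sup>L ?M k"]) auto
  then show ?thesis using lebesgue_integral_eq_integral[OF ki] by simp
qed

text \<open>The derivative of \<open>V\<close> is \<open>B * exp (- B * s)\<close> times
  \<open>u s - (A + B * integral {0..s} u)\<close>, which the hypothesis makes nonpositive; and
  \<open>V 0 = A\<close>.\<close>

lemma gronwall_integral:
  fixes u :: "real \<Rightarrow> real"
  assumes u: "continuous_on {0..T} u" and "B \<ge> 0"
    and le: "\<And>t. t \<in> {0..T} \<Longrightarrow> u t \<le> A + B * integral {0..t} u"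
    and t: "t \<in> {0..T}"
  shows "u t \<le> A * exp (B * t)"
proof -
  define V where "V s = (A + B * integral {0..s} u) * exp (- B * s)" for s
  have "V t \<le> V 0"
  proof (rule DERIV_nonpos_imp_decreasing_open[of 0 t V])
    show "0 \<le> t" using t by simp
    have "u integrable_on {0..t}"
      by (rule integrable_continuous_real[OF continuous_on_subset[OF u]]) (use t in auto)
    then show "continuous_on {0..t} V" unfolding V_def
      by (intro continuous_intros indefinite_integral_continuous_1)
    fix s assume s: "0 < s" "s < t"
    have "((\<lambda>s. integral {0..s} u) has_vector_derivative u s) (at s within {0..T})"
      by (rule integral_has_vector_derivative[OF u]) (use s t in auto)
    then have "((\<lambda>s. integral {0..s} u) has_real_derivative u s) (at s)"
      using s t by (simp add: has_real_derivative_iff_has_vector_derivative at_within_Icc_at)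
    note [derivative_intros] = this
    have "(V has_real_derivative (B * u s) * exp (- B * s) + (- B * exp (- B * s)) * (A + B * integral {0..s} u)) (at s)"
      unfolding V_def by (auto intro!: derivative_eq_intros simp: algebra_simps)
    moreover have "(B * u s) * exp (- B * s) + (- B * exp (- B * s)) * (A + B * integral {0..s} u)
       = B * exp (- B * s) * (u s - (A + B * integral {0..s} u))" by (simp add: algebra_simps)
    moreover have "\<dots> \<le> 0" using le[of s] s t \<open>B \<ge> 0\<close> by (intro mult_nonneg_nonpos) auto
    ultimately show "\<exists>y. (V has_real_derivative y) (at s) \<and> y \<le> 0" by metis
  qed
  then have "(A + B * integral {0..t} u) * exp (- B * t) \<le> A" by (simp add: V_def)
  then have "A + B * integral {0..t} u \<le> A * exp (B * t)"
    by (simp add: exp_minus field_simps)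
  then show ?thesis using le[OF t] by linarith
qed

section \<open>Regularity of the flow\<close>

text \<open>Testing the subgradient inequality at \<open>0\<close> bounds \<open>\<phi> z\<close>
  above. Finiteness is what allows values of \<open>\<phi>\<close> to be cancelled later.\<close>

lemma subdiff_nonneg_finite:
  assumes "\<phi> 0 = 0" "\<And>y. 0 \<le> \<phi> y" "\<xi> \<in> subdiff \<phi> z"
  shows "\<bar>\<phi> z\<bar> \<noteq> \<infinity>"
proof -
  have "\<phi> z + ereal (\<xi> \<bullet> (0 - z)) \<le> \<phi> 0" using assms(3) unfolding subdiff_def by blast
  then show ?thesis using assms(1) assms(2)[of z] by (cases "\<phi> z") auto
qed

lemma subdiff_monotone:
  assumes "\<phi> 0 = 0" "\<And>y. 0 \<le> \<phi> y" "\<xi> \<in> subdiff \<phi> z" "\<eta> \<in> subdiff \<phi> w"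
  shows "(z - w) \<bullet> (\<xi> - \<eta>) \<ge> 0"
proof -
  obtain a b where ab: "\<phi> z = ereal a" "\<phi> w = ereal b"
    using subdiff_nonneg_finite[of \<phi>, OF assms(1,2)] assms(3,4)
    by (metis ereal_real')
  have "\<phi> z + ereal (\<xi> \<bullet> (w - z)) \<le> \<phi> w" "\<phi> w + ereal (\<eta> \<bullet> (z - w)) \<le> \<phi> z"
    using assms(3,4) by (auto simp: subdiff_def)
  then show ?thesis
    unfolding ab by (simp add: inner_diff_left inner_diff_right inner_commute)
qed

lemma lipschitz_norm_vector_derivative_le:
  fixes f :: "real \<Rightarrow> 'a::real_normed_vector"
  assumes f: "(f has_vector_derivative D) (at t)" and "a < t" "t < b"
    and lip: "\<And>s. s \<in> {a..b} \<Longrightarrow> norm (f s - f t) \<le> K * \<bar>s - t\<bar>"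
  shows "norm D \<le> K"
proof (rule field_le_epsilon)
  fix e :: real assume "e > 0"
  then obtain d where "d > 0" and
    d: "\<And>s. norm (s - t) < d \<Longrightarrow> norm (f s - f t - (s - t) *\<^sub>R D) \<le> e * norm (s - t)"
    using f unfolding has_vector_derivative_def has_derivative_at_alt by blast
  define h where "h = min (d / 2) (b - t)"
  have h: "h > 0" "h < d" "t + h \<in> {a..b}" using \<open>d > 0\<close> assms(2,3) by (auto simp: h_def)
  have "h * norm D = norm (h *\<^sub>R D)" using h by simp
  also have "\<dots> \<le> norm (f (t + h) - f t) + norm (f (t + h) - f t - h *\<^sub>R D)"
    using norm_triangle_ineq4[of "f (t + h) - f t" "f (t + h) - f t - h *\<^sub>R D"] by simp
  also have "\<dots> \<le> K * h + e * h" using lip[OF h(3)] d[of "t + h"] h by (intro add_mono) auto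
  finally have "h * norm D \<le> h * (K + e)" by (simp add: algebra_simps)
  then show "norm D \<le> K + e" using h by simp
qed

text \<open>A solution comes with a derivative, a subgradient and exceptional sets for each horizon
  \<open>T\<close>. Here \<open>v'\<close> is one function and \<open>N\<close> one null set for all
  times, and the subgradient is recovered from the equation, so horizons can be changed
  freely.\<close>

locale friction_flow =
  fixes \<phi> :: "'a::real_inner \<Rightarrow> ereal" and G :: "'a \<Rightarrow> 'a" and \<gamma> \<beta> :: real
    and x v v' :: "real \<Rightarrow> 'a" and N :: "real set"
  assumes gamma: "\<gamma> > 0" and beta: "\<beta> \<ge> 0"
    and G_lipschitz: "\<And>B. bounded B \<Longrightarrow> \<exists>L. L-lipschitz_on B G"
    and phi_zero: "\<phi> 0 = 0" and phi_nonneg: "\<And>y. 0 \<le> \<phi> y" and phi_lsc: "lsc_fun \<phi>"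
    and v_start: "v 0 \<in> Dom_subdiff \<phi>"
    and x_primitive: "\<And>T. weak_primitive 0 T x v (\<lambda>t. norm (v t))"
    and v_primitive: "\<And>T. weak_primitive 0 T v v' (\<lambda>t. norm (v' t))"
    and v'_square: "\<And>T. (\<lambda>t. (norm (v' t))\<^sup>2) integrable_on {0..T}"
    and N: "negligible N"
    and x_deriv: "\<And>t. t > 0 \<Longrightarrow> t \<notin> N \<Longrightarrow> (x has_vector_derivative v t) (at t)"
    and v_deriv: "\<And>t. t > 0 \<Longrightarrow> t \<notin> N \<Longrightarrow> (v has_vector_derivative v' t) (at t)"
    and inclusion: "\<And>t. t > 0 \<Longrightarrow> t \<notin> N \<Longrightarrow>
        - (v' t + \<gamma> *\<^sub>R v t + G (x t + \<beta> *\<^sub>R v t)) \<in> subdiff \<phi> (v t)"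
begin

definition "y t = x t + \<beta> *\<^sub>R v t"
definition "p t = - (\<gamma> *\<^sub>R v t + G (y t))"
definition "\<xi> t = p t - v' t"

lemma \<xi>_eq: "\<xi> t = - (v' t + \<gamma> *\<^sub>R v t + G (x t + \<beta> *\<^sub>R v t))"
  by (simp add: \<xi>_def p_def y_def)

lemma xi: "t > 0 \<Longrightarrow> t \<notin> N \<Longrightarrow> \<xi> t \<in> subdiff \<phi> (v t)"
  using inclusion[of t] by (simp add: \<xi>_eq)

lemma v': "v' t = p t - \<xi> t"
  by (simp add: \<xi>_def)

lemma v_continuous: "continuous_on {0..} v"
proof -
  have "isCont v t" if "t > 0" for t
  proof -
    have "continuous_on {0<..<t + 1} v"
      using weak_primitive_continuous_on[OF v_primitive[of "t + 1"]] by (rule continuous_on_subset) auto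
    then show ?thesis using that by (simp add: continuous_on_eq_continuous_at)
  qed
  moreover have "continuous (at 0 within {0..}) v"
  proof -
    have "continuous (at 0 within {0..1}) v"
      using weak_primitive_continuous_on[OF v_primitive[of 1]] by (simp add: continuous_on_eq_continuous_within)
    then show ?thesis by (simp add: at_within_Icc_at_right at_within_Ici_at_right)
  qed
  ultimately show ?thesis
    unfolding continuous_on_eq_continuous_within
    by (metis atLeast_iff continuous_at_imp_continuous_at_within order_le_less)
qed

lemma v_continuous_Icc: "continuous_on {0..T} v"
  using v_continuous by (rule continuous_on_subset) auto

lemma v_bounded_on:
  obtains V where "V \<ge> 0" "\<And>t. t \<in> {0..T} \<Longrightarrow> norm (v t) \<le> V"
proof -
  have "bounded (v ` {0..T})"
    by (intro compact_imp_bounded compact_continuous_image v_continuous_Icc compact_Icc)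
  then obtain V where "V > 0" "\<And>z. z \<in> v ` {0..T} \<Longrightarrow> norm z \<le> V" by (auto simp: bounded_pos)
  then show thesis by (intro that[of V]) auto
qed

lemma x_lipschitz:
  assumes "\<And>t. t \<in> {0..T} \<Longrightarrow> norm (v t) \<le> V" "0 \<le> s" "s \<le> t" "t \<le> T"
  shows "norm (x t - x s) \<le> V * (t - s)"
proof -
  have "norm (x t - x s - (t - s) *\<^sub>R 0) \<le> integral {s..t} (\<lambda>_. V)"
    by (rule weak_primitive_norm_diff_le[OF x_primitive assms(2-4) integrable_const_ivl negligible_empty])
      (use assms in auto)
  then show ?thesis using assms by (simp add: mult.commute)
qed

lemma y_bounded: "bounded (y ` {0..T})"
proof -
  have "continuous_on {0..T} y"
    unfolding y_def
    by (intro continuous_intros v_continuous_Icc weak_primitive_continuous_on[OF x_primitive])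
  then show ?thesis by (intro compact_imp_bounded compact_continuous_image compact_Icc)
qed

text \<open>\<open>G\<close> is Lipschitz on the bounded set of points \<open>y\<close> visited, and
  \<open>x\<close> moves at bounded speed. The increment of \<open>v\<close> stays on the right
  because its regularity is still unknown: in the comparison with translates, \<open>c\<close>
  enters the Gronwall rate, while \<open>d\<close> contributes to both the rate and the
  source.\<close>

lemma p_lipschitz:
  obtains c d where "c \<ge> 0" "d \<ge> 0"
    "\<And>s t. 0 \<le> s \<Longrightarrow> s \<le> t \<Longrightarrow> t \<le> T \<Longrightarrow> norm (p t - p s) \<le> c * norm (v t - v s) + d * (t - s)"
proof -
  obtain V where V: "V \<ge> 0" "\<And>t. t \<in> {0..T} \<Longrightarrow> norm (v t) \<le> V"
    using v_bounded_on[of T] by blast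
  obtain L where L: "L-lipschitz_on (y ` {0..T}) G" using G_lipschitz[OF y_bounded] by blast
  then have "L \<ge> 0" by (rule lipschitz_on_nonneg)
  show thesis
  proof
    show "\<gamma> + L * \<beta> \<ge> 0" "L * V \<ge> 0" using gamma beta V \<open>L \<ge> 0\<close> by auto
    fix s t assume st: "0 \<le> s" "s \<le> t" "t \<le> T"
    have "norm (G (y t) - G (y s)) \<le> L * norm (y t - y s)"
      using lipschitz_onD[OF L, of "y t" "y s"] st by (simp add: dist_norm)
    also have "norm (y t - y s) \<le> norm (x t - x s) + norm (\<beta> *\<^sub>R (v t - v s))"
      using norm_triangle_ineq[of "x t - x s" "\<beta> *\<^sub>R (v t - v s)"] by (simp add: y_def algebra_simps)
    also have "\<dots> \<le> V * (t - s) + \<beta> * norm (v t - v s)"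
      using x_lipschitz[OF V(2) st] beta by simp
    finally have G: "norm (G (y t) - G (y s)) \<le> L * (V * (t - s) + \<beta> * norm (v t - v s))"
      using \<open>L \<ge> 0\<close> by (simp add: mult_left_mono)
    have "p t - p s = - (\<gamma> *\<^sub>R (v t - v s)) - (G (y t) - G (y s))"
      by (simp add: p_def algebra_simps)
    then have "norm (p t - p s) \<le> norm (\<gamma> *\<^sub>R (v t - v s)) + norm (G (y t) - G (y s))"
      by (metis norm_minus_cancel norm_triangle_ineq4)
    then show "norm (p t - p s) \<le> (\<gamma> + L * \<beta>) * norm (v t - v s) + (L * V) * (t - s)"
      using G gamma unfolding norm_scaleR by (simp add: algebra_simps)
  qed
qed

lemma p_bounded_on:
  obtains P where "P \<ge> 0" "\<And>t. t \<in> {0..T} \<Longrightarrow> norm (p t) \<le> P"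
proof -
  obtain V where V: "V \<ge> 0" "\<And>t. t \<in> {0..T} \<Longrightarrow> norm (v t) \<le> V"
    using v_bounded_on[of T] by blast
  obtain c d where cd: "c \<ge> 0" "d \<ge> 0"
    "\<And>s t. 0 \<le> s \<Longrightarrow> s \<le> t \<Longrightarrow> t \<le> T \<Longrightarrow> norm (p t - p s) \<le> c * norm (v t - v s) + d * (t - s)"
    using p_lipschitz[of T] by metis
  show thesis
  proof
    show "0 \<le> norm (p 0) + c * (V + V) + d * \<bar>T\<bar>" using cd V by simp
    fix t assume t: "t \<in> {0..T}"
    have "norm (p t) \<le> norm (p 0) + norm (p t - p 0)" by (metis norm_triangle_sub)
    also have "norm (p t - p 0) \<le> c * norm (v t - v 0) + d * (t - 0)" using cd(3)[of 0 t] t by auto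
    also have "\<dots> \<le> c * (V + V) + d * \<bar>T\<bar>"
      using cd t V(2)[of t] V(2)[of 0] norm_triangle_ineq4[of "v t" "v 0"]
      by (intro add_mono mult_left_mono) auto
    finally show "norm (p t) \<le> norm (p 0) + c * (V + V) + d * \<bar>T\<bar>" by simp
  qed
qed

text \<open>Compare with the constant \<open>v 0\<close>, which has a subgradient
  \<open>\<xi>0\<close>: monotonicity discards \<open>\<xi> \<tau> - \<xi>0\<close> and leaves
  \<open>?w \<tau> \<bullet> v' \<tau> \<le> C * norm (?w \<tau>)\<close>. Integrating up to a point
  \<open>r\<close> where \<open>norm (?w r)\<close> is maximal on \<open>{0..h}\<close> lets one
  factor cancel and gives slope \<open>2 * C\<close>.\<close>

lemma v_initial_slope:
  obtains C where "C \<ge> 0" "\<And>h. h \<in> {0..T} \<Longrightarrow> norm (v h - v 0) \<le> C * h"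
proof -
  obtain \<xi>0 where \<xi>0: "\<xi>0 \<in> subdiff \<phi> (v 0)" using v_start by (auto simp: Dom_subdiff_def)
  obtain P where P: "P \<ge> 0" "\<And>t. t \<in> {0..T} \<Longrightarrow> norm (p t) \<le> P"
    using p_bounded_on[of T] by blast
  define C where "C = norm \<xi>0 + P"
  have "C \<ge> 0" using P by (simp add: C_def)
  let ?w = "\<lambda>t. v t - v 0"
  have "norm (?w h) \<le> 2 * C * h" if h: "h \<in> {0..T}" for h
  proof -
    have cw: "continuous_on {0..h} (\<lambda>t. norm (?w t))"
      by (intro continuous_intros v_continuous_Icc)
    obtain r where r: "r \<in> {0..h}" and max: "\<And>t. t \<in> {0..h} \<Longrightarrow> norm (?w t) \<le> norm (?w r)"
      using continuous_attains_sup[OF compact_Icc _ cw] h by auto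
    have ci: "(\<lambda>t. C * norm (?w t)) integrable_on {0..r}"
      by (intro integrable_continuous_real continuous_intros v_continuous_Icc)
    have "(norm (?w r))\<^sup>2 - (norm (?w 0))\<^sup>2 \<le> 2 * integral {0..r} (\<lambda>t. C * norm (?w t))"
    proof (rule weak_primitive_norm_square_le[OF weak_primitive_diff_const[OF v_primitive] ci])
      show "negligible (N \<union> {0})" using N by simp
      fix \<tau> assume \<tau>: "\<tau> \<in> {0..r} - (N \<union> {0})"
      then have "0 \<le> ?w \<tau> \<bullet> (\<xi> \<tau> - \<xi>0)"
        using subdiff_monotone[of \<phi>, OF phi_zero phi_nonneg xi \<xi>0, of \<tau>] by auto
      moreover have "?w \<tau> \<bullet> v' \<tau> = ?w \<tau> \<bullet> (p \<tau> - \<xi>0) - ?w \<tau> \<bullet> (\<xi> \<tau> - \<xi>0)"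
        by (simp add: v' inner_diff_right)
      moreover have "?w \<tau> \<bullet> (p \<tau> - \<xi>0) \<le> norm (?w \<tau>) * norm (p \<tau> - \<xi>0)"
        by (rule norm_cauchy_schwarz)
      moreover have "norm (p \<tau> - \<xi>0) \<le> C"
        using P(2)[of \<tau>] norm_triangle_ineq4[of "p \<tau>" \<xi>0] \<tau> r h by (auto simp: C_def)
      ultimately show "?w \<tau> \<bullet> v' \<tau> \<le> C * norm (?w \<tau>)"
        using mult_left_mono[of "norm (p \<tau> - \<xi>0)" C "norm (?w \<tau>)"] by (simp add: mult.commute)
    qed (use r in auto)
    also have "integral {0..r} (\<lambda>t. C * norm (?w t)) \<le> integral {0..r} (\<lambda>t. C * norm (?w r))"
      using max r \<open>C \<ge> 0\<close> by (intro integral_le ci integrable_const_ivl mult_left_mono) auto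
    also have "\<dots> = r * (C * norm (?w r))" using r by simp
    also have "\<dots> \<le> h * (C * norm (?w r))" using r \<open>C \<ge> 0\<close> by (intro mult_right_mono) auto
    finally have "norm (?w r) * norm (?w r) \<le> norm (?w r) * (2 * C * h)"
      by (simp add: power2_eq_square algebra_simps)
    then have "norm (?w r) \<le> 2 * C * h"
      using \<open>C \<ge> 0\<close> h by (cases "?w r = 0") (auto simp: mult_le_cancel_left_pos)
    then show ?thesis using max[of h] h by auto
  qed
  then show thesis using \<open>C \<ge> 0\<close> by (intro that[of "2 * C"]) auto
qed

text \<open>Monotonicity of the subdifferential makes the flow compare well with its own translates; the
  initial slope is finite because \<open>v 0\<close> lies in the domain of the subdifferential.\<close>

lemma v_lipschitz:
  assumes "S \<ge> 0"
  obtains K where "K \<ge> 0" "\<And>s t. s \<in> {0..S} \<Longrightarrow> t \<in> {0..S} \<Longrightarrow> norm (v t - v s) \<le> K * \<bar>t - s\<bar>"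
proof -
  \<comment> \<open>Time and shift both range over \<open>{0..S}\<close>, so \<open>t + h\<close>
    can reach \<open>2 * S\<close>.\<close>
  obtain c d where cd: "c \<ge> 0" "d \<ge> 0"
    "\<And>s t. 0 \<le> s \<Longrightarrow> s \<le> t \<Longrightarrow> t \<le> 2 * S \<Longrightarrow> norm (p t - p s) \<le> c * norm (v t - v s) + d * (t - s)"
    using p_lipschitz[of "2 * S"] by metis
  obtain C where C: "C \<ge> 0" "\<And>h. h \<in> {0..S} \<Longrightarrow> norm (v h - v 0) \<le> C * h"
    using v_initial_slope[of S] by blast
  \<comment> \<open>Gronwall is applied to the squared norm of the shifted difference: initial value
    at most \<open>C\<^sup>2 * h\<^sup>2\<close>, source at most
    \<open>2 * d * S * h\<^sup>2\<close>, rate \<open>2 * (c + d)\<close>.\<close>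
  define K where "K = sqrt ((C\<^sup>2 + 2 * d * S) * exp (2 * (c + d) * S))"
  have shift: "norm (v (t + h) - v t) \<le> K * h" if h: "0 \<le> h" "h \<le> S" and t: "t \<in> {0..S}" for h t
  proof -
    let ?w = "\<lambda>t. v (t + h) - v t"
    let ?A = "(C\<^sup>2 + 2 * d * S) * h\<^sup>2"
    have wp: "weak_primitive 0 S ?w (\<lambda>t. v' (t + h) - v' t) (\<lambda>t. norm (v' (t + h)) + norm (v' t))"
      by (intro weak_primitive_diff v_primitive weak_primitive_translate
          weak_primitive_subinterval[OF v_primitive[of "S + h"]]) (use h in auto)
    have cw: "continuous_on {0..S} (\<lambda>t. (norm (?w t))\<^sup>2)"
      by (intro continuous_intros weak_primitive_continuous_on[OF wp])
    have "(norm (?w t))\<^sup>2 \<le> ?A * exp (2 * (c + d) * t)"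
    proof (rule gronwall_integral[OF cw _ _ t])
      show "0 \<le> 2 * (c + d)" using cd by simp
      fix t assume t: "t \<in> {0..S}"
      have wi: "(\<lambda>t. (norm (?w t))\<^sup>2) integrable_on {0..t}"
        by (rule integrable_continuous_real[OF continuous_on_subset[OF cw]]) (use t in auto)
      let ?k = "\<lambda>\<tau>. (c + d) * (norm (?w \<tau>))\<^sup>2 + d * h\<^sup>2"
      have ki: "?k integrable_on {0..t}"
        by (intro integrable_add integrable_on_mult_right wi integrable_const_ivl)
      have "(norm (?w t))\<^sup>2 - (norm (?w 0))\<^sup>2 \<le> 2 * integral {0..t} ?k"
      proof (rule weak_primitive_norm_square_le[OF weak_primitive_subinterval[OF wp] ki])
        \<comment> \<open>Both \<open>\<tau>\<close> and \<open>\<tau> + h\<close> have to avoid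
          \<open>N\<close>, so \<open>N\<close> shifted back by \<open>h\<close> is removed as
          well.\<close>
        show "negligible (N \<union> (+) (- h) ` N \<union> {0})"
          by (intro negligible_Un N negligible_translation) simp
        fix \<tau> assume \<tau>: "\<tau> \<in> {0..t} - (N \<union> (+) (- h) ` N \<union> {0})"
        then have "\<tau> > 0" "\<tau> \<notin> N" by auto
        have "\<tau> + h \<notin> N" using \<tau> by (auto simp: image_iff)
        have mono: "0 \<le> ?w \<tau> \<bullet> (\<xi> (\<tau> + h) - \<xi> \<tau>)"
          by (rule subdiff_monotone[of \<phi>, OF phi_zero phi_nonneg xi xi])
            (use \<open>\<tau> > 0\<close> \<open>\<tau> \<notin> N\<close> \<open>\<tau> + h \<notin> N\<close> h in auto)
        have "?w \<tau> \<bullet> (p (\<tau> + h) - p \<tau>) \<le> norm (?w \<tau>) * norm (p (\<tau> + h) - p \<tau>)"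
          by (rule norm_cauchy_schwarz)
        also have "\<dots> \<le> norm (?w \<tau>) * (c * norm (?w \<tau>) + d * h)"
          using cd(3)[of \<tau> "\<tau> + h"] \<tau> t h by (intro mult_left_mono) auto
        also have "\<dots> = c * (norm (?w \<tau>))\<^sup>2 + d * (norm (?w \<tau>) * h)"
          by (simp add: power2_eq_square algebra_simps)
        finally have "?w \<tau> \<bullet> (p (\<tau> + h) - p \<tau>)
            \<le> c * (norm (?w \<tau>))\<^sup>2 + d * (norm (?w \<tau>) * h)" .
        \<comment> \<open>Splitting the mixed term into squares leaves a source proportional to
          \<open>h\<^sup>2\<close>; after the square root the bound is linear in
          \<open>h\<close>.\<close>
        moreover have "d * (norm (?w \<tau>) * h) \<le> d * ((norm (?w \<tau>))\<^sup>2 + h\<^sup>2)"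
        proof (rule mult_left_mono)
          have "2 * norm (?w \<tau>) * h \<le> (norm (?w \<tau>))\<^sup>2 + h\<^sup>2" by (rule sum_squares_bound)
          moreover have "0 \<le> norm (?w \<tau>) * h" using h by simp
          ultimately show "norm (?w \<tau>) * h \<le> (norm (?w \<tau>))\<^sup>2 + h\<^sup>2" by linarith
        qed (rule cd)
        ultimately have "?w \<tau> \<bullet> (p (\<tau> + h) - p \<tau>) \<le> ?k \<tau>"
          by (simp only: distrib_left distrib_right)
        moreover have "?w \<tau> \<bullet> (v' (\<tau> + h) - v' \<tau>)
            = ?w \<tau> \<bullet> (p (\<tau> + h) - p \<tau>) - ?w \<tau> \<bullet> (\<xi> (\<tau> + h) - \<xi> \<tau>)"
          by (simp add: v' inner_diff_right)
        ultimately show "?w \<tau> \<bullet> (v' (\<tau> + h) - v' \<tau>) \<le> ?k \<tau>" using mono by linarith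
      qed (use t in auto)
      moreover have "integral {0..t} ?k = (c + d) * integral {0..t} (\<lambda>\<tau>. (norm (?w \<tau>))\<^sup>2) + t * (d * h\<^sup>2)"
        using wi t by (subst integral_add) (auto intro!: integrable_on_mult_right)
      moreover have "t * (d * h\<^sup>2) \<le> S * (d * h\<^sup>2)" using t cd by (intro mult_right_mono) auto
      moreover have "(norm (?w 0))\<^sup>2 \<le> C\<^sup>2 * h\<^sup>2"
        using C(2)[of h] h power_mono[of "norm (?w 0)" "C * h" 2] by (simp add: power_mult_distrib)
      ultimately show "(norm (?w t))\<^sup>2 \<le> ?A + 2 * (c + d) * integral {0..t} (\<lambda>t. (norm (?w t))\<^sup>2)"
        by (simp add: algebra_simps)
    qed
    also have "\<dots> \<le> ?A * exp (2 * (c + d) * S)"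
      using t cd \<open>S \<ge> 0\<close> by (intro mult_left_mono) (auto intro!: mult_left_mono)
    also have "\<dots> = (K * h)\<^sup>2"
      using cd \<open>S \<ge> 0\<close> by (simp add: K_def power_mult_distrib algebra_simps)
    finally show ?thesis
      by (rule power2_le_imp_le) (use h cd \<open>S \<ge> 0\<close> in \<open>simp add: K_def\<close>)
  qed
  show thesis
  proof
    show "K \<ge> 0" using cd \<open>S \<ge> 0\<close> by (simp add: K_def)
    show "norm (v t - v s) \<le> K * \<bar>t - s\<bar>" if "s \<in> {0..S}" "t \<in> {0..S}" for s t
      using shift[of "t - s" s] shift[of "s - t" t] that
      by (cases "s \<le> t") (auto simp: norm_minus_commute)
  qed
qed

end

section \<open>Energy dissipation\<close>

context friction_flow
begin

section \<open>Lipschitz continuity of the potential along the velocity\<close>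

lemma \<xi>_bounded:
  assumes "S \<ge> 0"
  obtains M where "M \<ge> 0" "\<And>t. t \<in> {0<..<S} - N \<Longrightarrow> norm (\<xi> t) \<le> M"
proof -
  obtain K where K: "K \<ge> 0" "\<And>s t. s \<in> {0..S} \<Longrightarrow> t \<in> {0..S} \<Longrightarrow> norm (v t - v s) \<le> K * \<bar>t - s\<bar>"
    using v_lipschitz[OF assms] by blast
  obtain P where P: "P \<ge> 0" "\<And>t. t \<in> {0..S} \<Longrightarrow> norm (p t) \<le> P"
    using p_bounded_on[of S] by blast
  show thesis
  proof
    show "P + K \<ge> 0" using P K by simp
    fix t assume t: "t \<in> {0<..<S} - N"
    have "norm (v' t) \<le> K"
      by (rule lipschitz_norm_vector_derivative_le[OF v_deriv, of t 0 S]) (use t K in auto)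
    then show "norm (\<xi> t) \<le> P + K"
      using norm_triangle_ineq4[of "p t" "v' t"] P(2)[of t] t by (simp add: \<xi>_def)
  qed
qed

text \<open>For \<open>t\<close> off \<open>N\<close>, the subgradient inequality at
  \<open>t\<close>, with bounded \<open>\<xi> t\<close>, compares \<open>\<phi> (v t)\<close> with
  \<open>\<phi> (v s)\<close> for every \<open>s\<close>. Such \<open>t\<close> are dense, and lower
  semicontinuity carries the upper bound on \<open>\<phi> (v t)\<close> to the remaining times. The
  bound is phrased in extended reals because finiteness of \<open>\<phi> (v t)\<close> is only
  deduced from it.\<close>

lemma phi_v_lipschitz:
  assumes "S > 0"
  obtains M where "M \<ge> 0"
    "\<And>s t. s \<in> {0..S} \<Longrightarrow> t \<in> {0..S} \<Longrightarrow> \<phi> (v t) \<le> \<phi> (v s) + ereal (M * \<bar>t - s\<bar>)"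
proof -
  obtain K where K: "K \<ge> 0" "\<And>s t. s \<in> {0..S} \<Longrightarrow> t \<in> {0..S} \<Longrightarrow> norm (v t - v s) \<le> K * \<bar>t - s\<bar>"
    using v_lipschitz[of S] \<open>S > 0\<close> by auto
  obtain M where M: "M \<ge> 0" "\<And>t. t \<in> {0<..<S} - N \<Longrightarrow> norm (\<xi> t) \<le> M"
    using \<xi>_bounded[of S] \<open>S > 0\<close> by auto
  have good: "\<phi> (v t) \<le> \<phi> (v s) + ereal (M * K * \<bar>t - s\<bar>)"
    if t: "t \<in> {0<..<S} - N" and s: "s \<in> {0..S}" for s t
  proof -
    have sub: "\<phi> (v t) + ereal (\<xi> t \<bullet> (v s - v t)) \<le> \<phi> (v s)"
      using xi[of t] t unfolding subdiff_def by auto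
    have "- (\<xi> t \<bullet> (v s - v t)) \<le> norm (\<xi> t) * norm (v s - v t)"
      using norm_cauchy_schwarz[of "- \<xi> t" "v s - v t"] by simp
    also have "\<dots> \<le> M * (K * \<bar>t - s\<bar>)"
      using M(2)[OF t] K(2)[of s t] s t \<open>M \<ge> 0\<close>
      by (intro mult_mono) (auto simp: norm_minus_commute)
    finally have "- (\<xi> t \<bullet> (v s - v t)) \<le> M * K * \<bar>t - s\<bar>" by simp
    with sub show ?thesis
      by (cases "\<phi> (v t)"; cases "\<phi> (v s)") auto
  qed
  have "\<phi> (v t) \<le> \<phi> (v s) + ereal (M * K * \<bar>t - s\<bar>)"
    if t: "t \<in> {0..S}" and s: "s \<in> {0..S}" for s t
  proof (cases "\<phi> (v s)")
    case (real c)
    show ?thesis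
    proof (rule ccontr)
      assume "\<not> ?thesis"
      then have "ereal (c + M * K * \<bar>t - s\<bar>) < \<phi> (v t)" using real by (simp add: not_le)
      then obtain c' where c': "c + M * K * \<bar>t - s\<bar> < c'" "ereal c' < \<phi> (v t)"
        using ereal_dense2 less_ereal.simps(1) by blast
      have "\<phi> (v t) \<le> Liminf (at (v t)) \<phi>" using phi_lsc by (simp add: lsc_fun_def)
      then have "\<forall>\<^sub>F z in at (v t). ereal c' < \<phi> z"
        using c'(2) less_LiminfD order_less_le_trans by blast
      then have "\<forall>\<^sub>F z in nhds (v t). ereal c' < \<phi> z"
        using c'(2) by (auto simp: eventually_nhds_conv_at)
      moreover have "filterlim v (nhds (v t)) (at t within {0..S})"
        using v_continuous_Icc[of S] t by (simp add: continuous_on_def)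
      ultimately have "\<forall>\<^sub>F \<tau> in at t within {0..S}. ereal c' < \<phi> (v \<tau>)"
        by (rule eventually_compose_filterlim)
      moreover have "((\<lambda>\<tau>. c + M * K * \<bar>\<tau> - s\<bar>) \<longlongrightarrow> c + M * K * \<bar>t - s\<bar>) (at t within {0..S})"
        by (intro tendsto_intros)
      then have "\<forall>\<^sub>F \<tau> in at t within {0..S}. c + M * K * \<bar>\<tau> - s\<bar> < c'"
        using c'(1) by (rule order_tendstoD)
      ultimately have "\<forall>\<^sub>F \<tau> in at t within {0..S}. ereal c' < \<phi> (v \<tau>) \<and> c + M * K * \<bar>\<tau> - s\<bar> < c'"
        by (rule eventually_conj)
      then obtain U where U: "open U" "t \<in> U"
        and near: "\<And>\<tau>. \<tau> \<in> U \<Longrightarrow> \<tau> \<noteq> t \<Longrightarrow> \<tau> \<in> {0..S} \<Longrightarrow> ereal c' < \<phi> (v \<tau>) \<and> c + M * K * \<bar>\<tau> - s\<bar> < c'"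
        unfolding eventually_at_topological by blast
      \<comment> \<open>The time \<open>t\<close> may be an end point, while \<open>good\<close>
        needs an interior time. The part of \<open>U\<close> inside the open interval is open and
        nonempty, hence not negligible, and so contains a time off \<open>N\<close>.\<close>
      have "t \<in> closure {0<..<S}" using t \<open>S > 0\<close> by simp
      then have "U \<inter> {0<..<S} \<noteq> {}"
        using U open_Int_closure_eq_empty[of U "{0<..<S}"] by auto
      then have "\<not> negligible (U \<inter> {0<..<S})"
        using U by (intro open_not_negligible open_Int) auto
      then have "\<not> U \<inter> {0<..<S} \<subseteq> N \<union> {t}"
        using N negligible_subset[of "N \<union> {t}"] by auto
      then obtain \<tau> where "\<tau> \<in> U \<inter> {0<..<S}" "\<tau> \<notin> N \<union> {t}" by blast
      then have \<tau>: "\<tau> \<in> U" "\<tau> \<in> {0<..<S} - N" "\<tau> \<noteq> t" by auto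
      have "\<phi> (v \<tau>) \<le> ereal (c + M * K * \<bar>\<tau> - s\<bar>)" using good[OF \<tau>(2) s] real by simp
      also have "\<dots> < \<phi> (v \<tau>)"
        using near[of \<tau>] \<tau> by (auto intro: less_trans[of _ "ereal c'"])
      finally show False by simp
    qed
  qed (use phi_nonneg[of "v s"] in auto)
  then show thesis using M K by (intro that[of "M * K"]) auto
qed

definition "\<Phi> t = real_of_ereal (\<phi> (v t))"

text \<open>Finiteness at time \<open>0\<close>, where the subdifferential is nonempty, spreads to
  every later time by the Lipschitz bound. So the value \<open>0\<close> that
  \<open>real_of_ereal\<close> assigns to infinity never occurs as such in \<open>\<Phi> t\<close>
  for \<open>t \<ge> 0\<close>.\<close>

lemma phi_v: "t \<ge> 0 \<Longrightarrow> \<phi> (v t) = ereal (\<Phi> t)"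
proof -
  assume "t \<ge> 0"
  obtain M where M: "\<And>s r. s \<in> {0..t + 1} \<Longrightarrow> r \<in> {0..t + 1} \<Longrightarrow> \<phi> (v r) \<le> \<phi> (v s) + ereal (M * \<bar>r - s\<bar>)"
    using phi_v_lipschitz[of "t + 1"] \<open>t \<ge> 0\<close> by (metis add_nonneg_pos zero_less_one)
  obtain \<xi>0 where "\<xi>0 \<in> subdiff \<phi> (v 0)" using v_start by (auto simp: Dom_subdiff_def)
  then have "\<bar>\<phi> (v 0)\<bar> \<noteq> \<infinity>" by (rule subdiff_nonneg_finite[of \<phi>, OF phi_zero phi_nonneg])
  then have "\<bar>\<phi> (v t)\<bar> \<noteq> \<infinity>" using M[of 0 t] phi_nonneg[of "v t"] \<open>t \<ge> 0\<close> by auto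
  then show ?thesis by (simp add: \<Phi>_def ereal_real')
qed

lemma \<Phi>_lipschitz:
  assumes "S > 0"
  obtains M where "M \<ge> 0" "\<And>s t. s \<in> {0..S} \<Longrightarrow> t \<in> {0..S} \<Longrightarrow> \<bar>\<Phi> t - \<Phi> s\<bar> \<le> M * \<bar>t - s\<bar>"
proof -
  obtain M where M: "M \<ge> 0"
    "\<And>s t. s \<in> {0..S} \<Longrightarrow> t \<in> {0..S} \<Longrightarrow> \<phi> (v t) \<le> \<phi> (v s) + ereal (M * \<bar>t - s\<bar>)"
    using phi_v_lipschitz[OF assms] by blast
  have "\<Phi> t \<le> \<Phi> s + M * \<bar>t - s\<bar>" if "s \<in> {0..S}" "t \<in> {0..S}" for s t
    using M(2)[OF that] phi_v[of s] phi_v[of t] that by simp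
  then show thesis using M(1) by (intro that[of M]) (force simp: abs_le_iff abs_minus_commute algebra_simps)+
qed

lemma y_lipschitz:
  assumes "S \<ge> 0"
  obtains M where "M \<ge> 0" "\<And>s t. s \<in> {0..S} \<Longrightarrow> t \<in> {0..S} \<Longrightarrow> norm (y t - y s) \<le> M * \<bar>t - s\<bar>"
proof -
  obtain K where K: "K \<ge> 0" "\<And>s t. s \<in> {0..S} \<Longrightarrow> t \<in> {0..S} \<Longrightarrow> norm (v t - v s) \<le> K * \<bar>t - s\<bar>"
    using v_lipschitz[OF assms] by blast
  obtain V where V: "V \<ge> 0" "\<And>t. t \<in> {0..S} \<Longrightarrow> norm (v t) \<le> V"
    using v_bounded_on[of S] by blast
  show thesis
  proof
    show "V + \<beta> * K \<ge> 0" using V K beta by simp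
    fix s t assume st: "s \<in> {0..S}" "t \<in> {0..S}"
    have "norm (x t - x s) \<le> V * \<bar>t - s\<bar>"
      using x_lipschitz[OF V(2), of S s t] x_lipschitz[OF V(2), of S t s] st
      by (cases "s \<le> t") (auto simp: norm_minus_commute)
    moreover have "\<beta> * norm (v t - v s) \<le> \<beta> * (K * \<bar>t - s\<bar>)"
      using K(2)[OF st] beta by (rule mult_left_mono)
    moreover have "norm (y t - y s) \<le> norm (x t - x s) + norm (\<beta> *\<^sub>R (v t - v s))"
      using norm_triangle_ineq[of "x t - x s" "\<beta> *\<^sub>R (v t - v s)"] by (simp add: y_def algebra_simps)
    ultimately show "norm (y t - y s) \<le> (V + \<beta> * K) * \<bar>t - s\<bar>"
      using beta unfolding norm_scaleR by (simp add: algebra_simps)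
  qed
qed

end

text \<open>The mean value inequality needs a convex set, so \<open>B\<close> is enlarged to a ball,
  on which the Lipschitz gradient is bounded. The radius is \<open>\<bar>R\<bar>\<close> because an
  empty \<open>B\<close> would admit a negative \<open>R\<close>, and the ball must contain
  \<open>0\<close>.\<close>

lemma GDERIV_lipschitz_on_bounded:
  fixes f :: "'a::real_inner \<Rightarrow> real"
  assumes f: "\<And>z. GDERIV f z :> G z" and G: "\<And>B. bounded B \<Longrightarrow> \<exists>L. L-lipschitz_on B G" and "bounded B"
  obtains M where "M \<ge> 0" "\<And>z w. z \<in> B \<Longrightarrow> w \<in> B \<Longrightarrow> \<bar>f z - f w\<bar> \<le> M * norm (z - w)"
proof -
  obtain R where "\<forall>z\<in>B. norm z \<le> R" using \<open>bounded B\<close> by (auto simp: bounded_iff)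
  then have R: "B \<subseteq> cball 0 R" by auto
  obtain L where L: "L-lipschitz_on (cball 0 \<bar>R\<bar>) G" using G[OF bounded_cball] by blast
  define M where "M = norm (G 0) + L * \<bar>R\<bar>"
  have GM: "norm (G z) \<le> M" if "z \<in> cball 0 \<bar>R\<bar>" for z
  proof -
    have "norm (G z - G 0) \<le> L * norm (z - 0)"
      using lipschitz_onD[OF L that, of 0] by (simp add: dist_norm)
    also have "\<dots> \<le> L * \<bar>R\<bar>"
      using that lipschitz_on_nonneg[OF L] by (intro mult_left_mono) auto
    finally show ?thesis using norm_triangle_sub[of "G z" "G 0"] by (simp add: M_def)
  qed
  have "M \<ge> 0" using order_trans[OF norm_ge_zero GM[of 0]] by simp
  show thesis
  proof
    show "M \<ge> 0" by fact
    fix z w assume "z \<in> B" "w \<in> B"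
    then have "z \<in> cball 0 \<bar>R\<bar>" "w \<in> cball 0 \<bar>R\<bar>" using R by (auto simp: subset_iff)
    moreover have "onorm (\<lambda>h. h \<bullet> G u) \<le> M" if "u \<in> cball 0 \<bar>R\<bar>" for u
    proof (rule onorm_bound[OF \<open>M \<ge> 0\<close>])
      fix h :: 'a
      have "norm (h \<bullet> G u) \<le> norm h * norm (G u)" by (simp add: Cauchy_Schwarz_ineq2)
      also have "\<dots> \<le> M * norm h"
        using mult_right_mono[OF GM[OF that] norm_ge_zero[of h]] by (simp add: mult.commute)
      finally show "norm (h \<bullet> G u) \<le> M * norm h" .
    qed
    ultimately have "norm (f z - f w) \<le> M * norm (z - w)"
      by (intro differentiable_bound[of "cball 0 \<bar>R\<bar>" f "\<lambda>u h. h \<bullet> G u"])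
        (use f in \<open>auto simp: gderiv_def intro: has_derivative_at_withinI\<close>)
    then show "\<bar>f z - f w\<bar> \<le> M * norm (z - w)" by simp
  qed
qed

text \<open>The subgradient inequality at \<open>t\<close> bounds \<open>\<Phi> t - \<Phi> (t - h)\<close> only from above, so only left
  difference quotients of the energy are controlled; differentiability of \<open>\<Phi>\<close> is not needed.\<close>

lemma (in friction_flow) energy_dissipation:
  fixes f :: "'a \<Rightarrow> real"
  assumes f: "\<And>z. GDERIV f z :> G z" and "S \<ge> 0"
  defines "E \<equiv> \<lambda>t. f (y t) + (1 + \<beta> * \<gamma>) / 2 * (norm (v t))\<^sup>2 + \<beta> * \<Phi> t"
  shows "E S - E 0 \<le> - integral {0..S} (\<lambda>t. \<gamma> * (norm (v t))\<^sup>2 + \<beta> * (norm (v' t))\<^sup>2)"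
proof (cases "S = 0")
  case False
  then have "S > 0" using \<open>S \<ge> 0\<close> by simp
  let ?c = "(1 + \<beta> * \<gamma>) / 2"
  let ?d = "\<lambda>t. \<gamma> * (norm (v t))\<^sup>2 + \<beta> * (norm (v' t))\<^sup>2"
  have "?c \<ge> 0" using beta gamma by simp
  obtain K where K: "K \<ge> 0" "\<And>s t. s \<in> {0..S} \<Longrightarrow> t \<in> {0..S} \<Longrightarrow> norm (v t - v s) \<le> K * \<bar>t - s\<bar>"
    using v_lipschitz[OF \<open>S \<ge> 0\<close>] by blast
  obtain V where V: "V \<ge> 0" "\<And>t. t \<in> {0..S} \<Longrightarrow> norm (v t) \<le> V" using v_bounded_on[of S] by blast
  obtain Y where Y: "Y \<ge> 0" "\<And>s t. s \<in> {0..S} \<Longrightarrow> t \<in> {0..S} \<Longrightarrow> norm (y t - y s) \<le> Y * \<bar>t - s\<bar>"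
    using y_lipschitz[OF \<open>S \<ge> 0\<close>] by blast
  obtain M where M: "M \<ge> 0" "\<And>s t. s \<in> {0..S} \<Longrightarrow> t \<in> {0..S} \<Longrightarrow> \<bar>\<Phi> t - \<Phi> s\<bar> \<le> M * \<bar>t - s\<bar>"
    using \<Phi>_lipschitz[OF \<open>S > 0\<close>] by blast
  obtain A where A: "A \<ge> 0" "\<And>z w. z \<in> y ` {0..S} \<Longrightarrow> w \<in> y ` {0..S} \<Longrightarrow> \<bar>f z - f w\<bar> \<le> A * norm (z - w)"
    using GDERIV_lipschitz_on_bounded[OF f G_lipschitz y_bounded[of S]] by blast
  have "E S - E 0 \<le> integral {0..S} (\<lambda>t. - ?d t)"
  proof (rule lipschitz_increment_le_integral[OF \<open>S \<ge> 0\<close> _ _ _ N])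
    show "0 \<le> A * Y + ?c * (2 * V * K) + \<beta> * M" using A Y \<open>?c \<ge> 0\<close> V K beta M by simp
    show "\<bar>E t - E s\<bar> \<le> (A * Y + ?c * (2 * V * K) + \<beta> * M) * \<bar>t - s\<bar>"
      if st: "s \<in> {0..S}" "t \<in> {0..S}" for s t
    proof -
      have "\<bar>f (y t) - f (y s)\<bar> \<le> A * (Y * \<bar>t - s\<bar>)"
        using A(2)[of "y t" "y s"] mult_left_mono[OF Y(2)[OF st] A(1)] st by auto
      moreover have "\<bar>(norm (v t))\<^sup>2 - (norm (v s))\<^sup>2\<bar> \<le> 2 * V * (K * \<bar>t - s\<bar>)"
      proof -
        have "(norm (v t))\<^sup>2 - (norm (v s))\<^sup>2 = (norm (v t) + norm (v s)) * (norm (v t) - norm (v s))"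
          by (simp add: power2_eq_square algebra_simps)
        then have "\<bar>(norm (v t))\<^sup>2 - (norm (v s))\<^sup>2\<bar> = (norm (v t) + norm (v s)) * \<bar>norm (v t) - norm (v s)\<bar>"
          by (simp add: abs_mult)
        also have "\<dots> \<le> (2 * V) * (K * \<bar>t - s\<bar>)"
          using V(2)[OF st(1)] V(2)[OF st(2)] norm_triangle_ineq3[of "v t" "v s"] K(2)[OF st] V(1)
          by (intro mult_mono) auto
        finally show ?thesis by simp
      qed
      then have "?c * \<bar>(norm (v t))\<^sup>2 - (norm (v s))\<^sup>2\<bar> \<le> ?c * (2 * V * (K * \<bar>t - s\<bar>))"
        using \<open>?c \<ge> 0\<close> by (rule mult_left_mono)
      moreover have "\<beta> * \<bar>\<Phi> t - \<Phi> s\<bar> \<le> \<beta> * (M * \<bar>t - s\<bar>)"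
        using M(2)[OF st] beta by (rule mult_left_mono)
      moreover have "\<bar>E t - E s\<bar> \<le> \<bar>f (y t) - f (y s)\<bar> + ?c * \<bar>(norm (v t))\<^sup>2 - (norm (v s))\<^sup>2\<bar> + \<beta> * \<bar>\<Phi> t - \<Phi> s\<bar>"
      proof -
        have "E t - E s = (f (y t) - f (y s)) + ?c * ((norm (v t))\<^sup>2 - (norm (v s))\<^sup>2) + \<beta> * (\<Phi> t - \<Phi> s)"
          unfolding E_def by (simp only: right_diff_distrib)
        then show ?thesis
          using abs_triangle_ineq[of "(f (y t) - f (y s)) + ?c * ((norm (v t))\<^sup>2 - (norm (v s))\<^sup>2)" "\<beta> * (\<Phi> t - \<Phi> s)"]
            abs_triangle_ineq[of "f (y t) - f (y s)" "?c * ((norm (v t))\<^sup>2 - (norm (v s))\<^sup>2)"]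
            \<open>?c \<ge> 0\<close> beta by (simp only: abs_mult abs_of_nonneg)
      qed
      ultimately have "\<bar>E t - E s\<bar> \<le> A * (Y * \<bar>t - s\<bar>) + ?c * (2 * V * (K * \<bar>t - s\<bar>)) + \<beta> * (M * \<bar>t - s\<bar>)"
        by linarith
      then show ?thesis by (simp only: distrib_right mult.assoc)
    qed
    have "?d integrable_on {0..S}"
      by (intro integrable_add integrable_on_mult_right v'_square integrable_continuous_real
          continuous_intros v_continuous_Icc)
    then have "?d absolutely_integrable_on {0..S}"
      by (rule nonnegative_absolutely_integrable_1) (use gamma beta in auto)
    then show "(\<lambda>t. - ?d t) absolutely_integrable_on {0..S}"
      using set_integrable_mult_right[of "- 1" lebesgue "{0..S}" ?d] by simp
    fix t e :: real assume t: "t \<in> {0<..<S} - N" and "e > 0"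
    then have "t > 0" "t \<notin> N" by auto
    \<comment> \<open>In \<open>R\<close> the nonsmooth \<open>\<Phi> s\<close> is replaced by the
      linear function \<open>\<xi> t \<bullet> v s\<close> with the subgradient frozen at
      \<open>t\<close>. It is differentiable at \<open>t\<close>, and the subgradient inequality
      makes left increments of \<open>E\<close> at most those of \<open>R\<close>.\<close>
    define R where "R s = f (y s) + ?c * (v s \<bullet> v s) + \<beta> * (\<xi> t \<bullet> v s)" for s
    have yd: "(y has_derivative (\<lambda>h. h *\<^sub>R v t + \<beta> *\<^sub>R (h *\<^sub>R v' t))) (at t)"
      using x_deriv[OF \<open>t > 0\<close> \<open>t \<notin> N\<close>] v_deriv[OF \<open>t > 0\<close> \<open>t \<notin> N\<close>]
      unfolding y_def[abs_def] has_vector_derivative_def by (intro derivative_intros)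
    have fd: "((\<lambda>s. f (y s)) has_derivative (\<lambda>h. (h *\<^sub>R v t + \<beta> *\<^sub>R (h *\<^sub>R v' t)) \<bullet> G (y t))) (at t)"
      using has_derivative_compose[OF yd] f[of "y t"] by (simp add: gderiv_def)
    have vd: "(v has_derivative (\<lambda>h. h *\<^sub>R v' t)) (at t)"
      using v_deriv[OF \<open>t > 0\<close> \<open>t \<notin> N\<close>] by (simp add: has_vector_derivative_def)
    \<comment> \<open>Substituting the equation for \<open>G (y t)\<close> in the derivative of
      \<open>R\<close> cancels every \<open>v t \<bullet> v' t\<close> and
      \<open>\<xi> t \<bullet> v' t\<close>; this fixes the coefficient
      \<open>(1 + \<beta> * \<gamma>) / 2\<close>.\<close>
    let ?D = "- \<gamma> * (norm (v t))\<^sup>2 - v t \<bullet> \<xi> t - \<beta> * (norm (v' t))\<^sup>2"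
    have "(R has_derivative (\<lambda>h. (h *\<^sub>R v t + \<beta> *\<^sub>R (h *\<^sub>R v' t)) \<bullet> G (y t)
        + ?c * (v t \<bullet> (h *\<^sub>R v' t) + (h *\<^sub>R v' t) \<bullet> v t) + \<beta> * (\<xi> t \<bullet> (h *\<^sub>R v' t)))) (at t)"
      unfolding R_def[abs_def] by (intro derivative_intros fd vd)
    moreover have "(h *\<^sub>R v t + \<beta> *\<^sub>R (h *\<^sub>R v' t)) \<bullet> G (y t)
        + ?c * (v t \<bullet> (h *\<^sub>R v' t) + (h *\<^sub>R v' t) \<bullet> v t) + \<beta> * (\<xi> t \<bullet> (h *\<^sub>R v' t)) = ?D * h" for h
    proof -
      have G: "G (y t) = - v' t - \<gamma> *\<^sub>R v t - \<xi> t" by (simp add: \<xi>_def p_def)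
      show ?thesis unfolding G
        by (simp add: inner_diff_right inner_add_left inner_add_right inner_commute power2_norm_eq_inner field_simps)
    qed
    ultimately have "(R has_derivative (\<lambda>h. ?D * h)) (at t)" by simp
    then obtain \<delta> where "\<delta> > 0" and \<delta>: "\<And>s. norm (s - t) < \<delta> \<Longrightarrow> norm (R s - R t - ?D * (s - t)) \<le> e * norm (s - t)"
      using \<open>e > 0\<close> unfolding has_derivative_at_alt by blast
    have "\<phi> 0 + ereal (0 \<bullet> (w - 0)) \<le> \<phi> w" for w
      using phi_nonneg[of w] by (simp add: phi_zero zero_ereal_def)
    then have "0 \<in> subdiff \<phi> 0" unfolding subdiff_def by blast
    then have "v t \<bullet> \<xi> t \<ge> 0"
      using subdiff_monotone[of \<phi> "\<xi> t" "v t" 0 0, OF phi_zero phi_nonneg xi] \<open>t > 0\<close> \<open>t \<notin> N\<close>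
      by simp
    then have "?D \<le> - ?d t" by simp
    have "\<forall>\<^sub>F h in at_right 0. h \<in> {0<..<min \<delta> t}"
      by (rule eventually_at_right_real) (use \<open>\<delta> > 0\<close> \<open>t > 0\<close> in auto)
    then show "\<forall>\<^sub>F h in at_right 0. E t - E (t - h) \<le> (- ?d t + e) * h"
    proof eventually_elim
      case (elim h)
      have sub: "\<phi> (v t) + ereal (\<xi> t \<bullet> (v (t - h) - v t)) \<le> \<phi> (v (t - h))"
        using xi[OF \<open>t > 0\<close> \<open>t \<notin> N\<close>] unfolding subdiff_def by blast
      then have "\<Phi> t - \<Phi> (t - h) \<le> \<xi> t \<bullet> v t - \<xi> t \<bullet> v (t - h)"
        using phi_v[of t] phi_v[of "t - h"] elim \<open>t > 0\<close> by (simp add: inner_diff_right)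
      then have "\<beta> * (\<Phi> t - \<Phi> (t - h)) \<le> \<beta> * (\<xi> t \<bullet> v t - \<xi> t \<bullet> v (t - h))"
        using beta by (rule mult_left_mono)
      then have "E t - E (t - h) \<le> R t - R (t - h)"
        by (simp add: E_def R_def power2_norm_eq_inner right_diff_distrib)
      also have "\<dots> \<le> ?D * h + e * h" using \<delta>[of "t - h"] elim by (simp add: abs_le_iff)
      also have "\<dots> \<le> (- ?d t + e) * h"
        using \<open>?D \<le> - ?d t\<close> elim by (simp only: distrib_right[symmetric] mult_right_mono add_right_mono greaterThanLessThan_iff less_imp_le)
      finally show ?case .
    qed
  qed
  then show ?thesis by (simp only: integral_neg)
qed (simp add: E_def)

section \<open>Vanishing velocity and finite stopping\<close>

context friction_flow
begin

lemma v_tendsto_zero: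
  fixes f :: "'a \<Rightarrow> real"
  assumes f: "\<And>z. GDERIV f z :> G z" and bdd: "bdd_below (range f)" and "\<beta> > 0"
  shows "(v \<longlongrightarrow> 0) at_top"
proof -
  define g where "g t = (norm (v t))\<^sup>2 + (norm (v' t))\<^sup>2" for t
  define J where "J t = integral {0..t} g" for t
  have gi: "g integrable_on {0..T}" for T
    unfolding g_def by (intro integrable_add v'_square integrable_continuous_real continuous_intros v_continuous_Icc)
  have gi': "g integrable_on {s..t}" if "0 \<le> s" for s t
    by (rule integrable_on_subinterval[OF gi[of t]]) (use that in auto)
  have Jdiff: "J t - J s = integral {s..t} g" if "0 \<le> s" "s \<le> t" for s t
    using Henstock_Kurzweil_Integration.integral_combine[OF that gi] by (simp add: J_def)
  have g0: "0 \<le> g t" for t by (simp add: g_def)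
  have Jmono: "J s \<le> J t" if "0 \<le> s" "s \<le> t" for s t
    using Jdiff[OF that] integral_nonneg[OF gi'[of s t]] that g0 by auto
  obtain m where m: "\<And>z. m \<le> f z" using bdd by (auto simp: bdd_below_def)
  define E where "E t = f (y t) + (1 + \<beta> * \<gamma>) / 2 * (norm (v t))\<^sup>2 + \<beta> * \<Phi> t" for t
  \<comment> \<open>The dissipation dominates \<open>?c * g\<close>; positivity of \<open>?c\<close>
    is where \<open>\<beta> > 0\<close> enters.\<close>
  let ?c = "min \<gamma> \<beta>"
  have "?c > 0" using gamma \<open>\<beta> > 0\<close> by simp
  have Jb: "J t \<le> (E 0 - m) / ?c" if "t \<ge> 0" for t
  proof -
    have "?c * J t = integral {0..t} (\<lambda>\<tau>. ?c * g \<tau>)" by (simp add: J_def)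
    also have "\<dots> \<le> integral {0..t} (\<lambda>\<tau>. \<gamma> * (norm (v \<tau>))\<^sup>2 + \<beta> * (norm (v' \<tau>))\<^sup>2)"
    proof (rule integral_le)
      show "(\<lambda>\<tau>. ?c * g \<tau>) integrable_on {0..t}" using gi by (rule integrable_on_mult_right)
      show "(\<lambda>\<tau>. \<gamma> * (norm (v \<tau>))\<^sup>2 + \<beta> * (norm (v' \<tau>))\<^sup>2) integrable_on {0..t}"
        by (intro integrable_add integrable_on_mult_right v'_square integrable_continuous_real
            continuous_intros v_continuous_Icc)
      show "?c * g \<tau> \<le> \<gamma> * (norm (v \<tau>))\<^sup>2 + \<beta> * (norm (v' \<tau>))\<^sup>2" for \<tau>
        unfolding g_def distrib_left by (intro add_mono mult_right_mono) auto
    qed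
    also have "\<dots> \<le> E 0 - E t"
      using energy_dissipation[OF f that] by (simp add: E_def)
    also have "\<dots> \<le> E 0 - m"
    proof -
      have "\<Phi> t \<ge> 0" using phi_nonneg[of "v t"] by (simp add: \<Phi>_def real_of_ereal_pos)
      moreover have "(1 + \<beta> * \<gamma>) / 2 * (norm (v t))\<^sup>2 \<ge> 0" using gamma beta by simp
      ultimately have "m \<le> E t" using m[of "y t"] beta mult_nonneg_nonneg[of \<beta> "\<Phi> t"] unfolding E_def by linarith
      then show ?thesis by simp
    qed
    finally show ?thesis using \<open>?c > 0\<close> by (simp only: pos_le_divide_eq mult.commute)
  qed
  \<comment> \<open>For \<open>s\<close> in the unit window before \<open>t\<close>,
    \<open>(norm (v t))\<^sup>2\<close> exceeds \<open>(norm (v s))\<^sup>2\<close> by at most the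
    integral of \<open>g\<close> over the window. Averaging over \<open>s\<close> bounds the
    remaining \<open>g s\<close> by the same integral, hence the factor \<open>2\<close>.\<close>
  have vJ: "(norm (v t))\<^sup>2 \<le> 2 * (J t - J (t - 1))" if "t \<ge> 1" for t
  proof -
    let ?\<delta> = "J t - J (t - 1)"
    have 1: "(norm (v t))\<^sup>2 \<le> g s + ?\<delta>" if s: "s \<in> {t - 1..t}" for s
    proof -
      have "s \<ge> 0" using s \<open>t \<ge> 1\<close> by auto
      have "(norm (v t))\<^sup>2 - (norm (v s))\<^sup>2 \<le> 2 * integral {s..t} (\<lambda>\<tau>. 1 / 2 * g \<tau>)"
      proof (rule weak_primitive_norm_square_le[OF weak_primitive_subinterval[OF v_primitive[of t]] _ negligible_empty])
        show "(\<lambda>\<tau>. 1 / 2 * g \<tau>) integrable_on {s..t}"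
          using gi'[OF \<open>s \<ge> 0\<close>] by (rule integrable_on_mult_right)
        show "v \<tau> \<bullet> v' \<tau> \<le> 1 / 2 * g \<tau>" for \<tau>
          using norm_cauchy_schwarz[of "v \<tau>" "v' \<tau>"] sum_squares_bound[of "norm (v \<tau>)" "norm (v' \<tau>)"]
          by (simp add: g_def)
      qed (use s \<open>s \<ge> 0\<close> in auto)
      also have "\<dots> = J t - J s" using Jdiff[OF \<open>s \<ge> 0\<close>, of t] s by simp
      also have "\<dots> \<le> ?\<delta>" using Jmono[of "t - 1" s] s \<open>t \<ge> 1\<close> by simp
      finally show ?thesis using zero_le_power2[of "norm (v' s)"] unfolding g_def by linarith
    qed
    have "(norm (v t))\<^sup>2 = integral {t - 1..t} (\<lambda>s. (norm (v t))\<^sup>2)" by simp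
    also have "\<dots> \<le> integral {t - 1..t} (\<lambda>s. g s + ?\<delta>)"
      by (rule integral_le) (use 1 gi'[of "t - 1" t] \<open>t \<ge> 1\<close> in \<open>auto intro!: integrable_add\<close>)
    also have "\<dots> = integral {t - 1..t} g + ?\<delta>"
      using gi'[of "t - 1" t] \<open>t \<ge> 1\<close> by (subst integral_add) auto
    also have "\<dots> = 2 * ?\<delta>" using Jdiff[of "t - 1" t] \<open>t \<ge> 1\<close> by simp
    finally show ?thesis .
  qed
  \<comment> \<open>\<open>J\<close> is increasing and bounded, so its increments over unit windows
    tend to \<open>0\<close>; the factor \<open>2\<close> in \<open>vJ\<close> explains the
    tolerance \<open>e\<^sup>2 / 2\<close> below.\<close>
  define L where "L = (SUP t\<in>{0..}. J t)"
  have bddJ: "bdd_above (J ` {0..})" using Jb by (auto simp: bdd_above_def)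
  show ?thesis
  proof (rule tendstoI)
    fix e :: real assume "e > 0"
    then have "L - e\<^sup>2 / 2 < L" by simp
    then obtain t0 where t0: "t0 \<ge> 0" "L - e\<^sup>2 / 2 < J t0"
      unfolding L_def using less_cSUP_iff[OF _ bddJ] by auto
    have "dist (v t) 0 < e" if "t \<ge> t0 + 1" for t
    proof -
      have "J t \<le> L" unfolding L_def using bddJ t0 that by (intro cSUP_upper) auto
      moreover have "J t0 \<le> J (t - 1)" using t0 that by (intro Jmono) auto
      ultimately have "(norm (v t))\<^sup>2 < e\<^sup>2" using vJ[of t] t0 that by simp
      then show ?thesis using \<open>e > 0\<close> by (simp add: power2_less_imp_less)
    qed
    then show "\<forall>\<^sub>F t in at_top. dist (v t) 0 < e"
      unfolding eventually_at_top_linorder by blast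
  qed
qed

lemma norm_v_deriv:
  assumes "t > 0" "t \<notin> N" "v t \<noteq> 0"
  shows "((\<lambda>s. norm (v s)) has_real_derivative (v t \<bullet> v' t) / norm (v t)) (at t)"
proof -
  have "(v has_derivative (\<lambda>h. h *\<^sub>R v' t)) (at t)"
    using v_deriv[OF assms(1,2)] by (simp add: has_vector_derivative_def)
  from has_derivative_compose[OF this has_derivative_norm[OF assms(3)]]
  have "((\<lambda>s. norm (v s)) has_derivative (\<lambda>h. (h *\<^sub>R v' t) \<bullet> sgn (v t))) (at t)" .
  moreover have "(\<lambda>h. (h *\<^sub>R v' t) \<bullet> sgn (v t)) = (*) ((v t \<bullet> v' t) / norm (v t))"
    by (rule ext) (simp add: sgn_div_norm divide_inverse inner_commute mult_ac)
  ultimately show ?thesis by (simp only: has_field_derivative_def)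
qed

section \<open>Decay of the speed when the force stays inside the subdifferential at zero\<close>

context
  fixes T0 \<epsilon> :: real
  assumes T0: "T0 \<ge> 0" and eps: "\<epsilon> > 0"
    and interior_force: "\<And>t. t \<ge> T0 \<Longrightarrow> cball (- G (y t)) \<epsilon> \<subseteq> subdiff \<phi> 0"
begin

lemma friction_dissipation:
  assumes t: "t > 0" "t \<notin> N" "t \<ge> T0"
  shows "v t \<bullet> v' t \<le> norm (v t) * (- \<gamma> * norm (v t) - \<epsilon>)"
proof (cases "v t = 0")
  case False
  let ?u = "- G (y t) + \<epsilon> *\<^sub>R sgn (v t)"
  have "?u \<in> cball (- G (y t)) \<epsilon>" using eps False by (simp add: dist_norm norm_sgn)
  then have "?u \<in> subdiff \<phi> 0" using interior_force[OF t(3)] by blast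
  then have "0 \<le> v t \<bullet> (\<xi> t - ?u)"
    using subdiff_monotone[of \<phi>, OF phi_zero phi_nonneg xi[OF t(1,2)], of ?u 0] by simp
  moreover have "v t \<bullet> v' t = - \<gamma> * (norm (v t))\<^sup>2 - v t \<bullet> (\<xi> t - ?u) - \<epsilon> * (v t \<bullet> sgn (v t))"
    by (simp add: v' p_def inner_diff_right inner_add_right power2_norm_eq_inner)
  moreover have "v t \<bullet> sgn (v t) = norm (v t)"
    using False by (simp add: sgn_div_norm power2_norm_eq_inner[symmetric] power2_eq_square)
  ultimately show ?thesis by (simp add: power2_eq_square algebra_simps)
qed simp

text \<open>It has two uses: a velocity that vanishes once stays zero, and one that is nonzero at
  some time was nonzero ever since \<open>T0\<close>, so its norm could be differentiated along the
  way.\<close>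

lemma norm_v_decreasing:
  assumes "T0 \<le> s" "s \<le> t"
  shows "norm (v t) \<le> norm (v s)"
proof -
  have "(norm (v t))\<^sup>2 - (norm (v s))\<^sup>2 \<le> 2 * integral {s..t} (\<lambda>_. 0)"
  proof (rule weak_primitive_norm_square_le[OF weak_primitive_subinterval[OF v_primitive[of t]]])
    show "negligible (N \<union> {0})" using N by simp
    fix \<tau> assume \<tau>: "\<tau> \<in> {s..t} - (N \<union> {0})"
    then have "v \<tau> \<bullet> v' \<tau> \<le> norm (v \<tau>) * (- \<gamma> * norm (v \<tau>) - \<epsilon>)"
      using T0 assms by (intro friction_dissipation) auto
    also have "\<dots> \<le> 0"
    proof (rule mult_nonneg_nonpos)
      have "\<gamma> * norm (v \<tau>) \<ge> 0" using gamma by simp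
      then show "- \<gamma> * norm (v \<tau>) - \<epsilon> \<le> 0" using eps by simp
    qed simp
    finally show "v \<tau> \<bullet> v' \<tau> \<le> 0" .
  qed (use T0 assms in auto)
  then show ?thesis by simp
qed

lemma norm_v_deriv_le:
  assumes t: "t > 0" "t \<notin> N" "t \<ge> T0" "v t \<noteq> 0"
  shows "(v t \<bullet> v' t) / norm (v t) + \<gamma> * norm (v t) + \<epsilon> \<le> 0"
  using friction_dissipation[OF t(1-3)] t(4) by (simp add: field_simps)

text \<open>The time at which the solution of \<open>n' = - \<gamma> n - \<epsilon>\<close> starting
  from \<open>norm (v T0)\<close> at \<open>T0\<close> reaches zero.\<close>

definition "stop_time = T0 + 1 / \<gamma> * ln (1 + \<gamma> * norm (v T0) / \<epsilon>)"

text \<open>The norm is not differentiable at zero, so the proof goes by contradiction: if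
  \<open>v\<close> were nonzero at \<open>stop_time\<close> it would be nonzero on the whole
  interval, \<open>H\<close> would fall at rate at least \<open>\<gamma>\<close> and end at most at
  \<open>0\<close>, yet \<open>H\<close> is positive where \<open>v\<close> is nonzero.\<close>

lemma v_stop_time: "v stop_time = 0"
proof (rule ccontr)
  let ?T = stop_time
  assume nz: "v ?T \<noteq> 0"
  have pos: "\<gamma> * norm (v t) / \<epsilon> \<ge> 0" for t using gamma eps by simp
  have "T0 \<le> ?T" using gamma pos[of T0] by (simp add: stop_time_def)
  define H where "H t = ln (1 + \<gamma> * norm (v t) / \<epsilon>)" for t
  obtain K where K: "K \<ge> 0" "\<And>s t. s \<in> {0..?T} \<Longrightarrow> t \<in> {0..?T} \<Longrightarrow> norm (v t - v s) \<le> K * \<bar>t - s\<bar>"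
    using v_lipschitz[of ?T] T0 \<open>T0 \<le> ?T\<close> by auto
  \<comment> \<open>The logarithm has slope at most \<open>1\<close> on arguments
    \<open>\<ge> 1\<close>, so \<open>H\<close> inherits the Lipschitz constant of \<open>v\<close>
    up to the factor \<open>\<gamma> / \<epsilon>\<close>.\<close>
  have Hle: "H t - H s \<le> \<gamma> / \<epsilon> * K * \<bar>t - s\<bar>" if st: "s \<in> {T0..?T}" "t \<in> {T0..?T}" for s t
  proof -
    have "H t - H s \<le> (\<gamma> * norm (v t) / \<epsilon> - \<gamma> * norm (v s) / \<epsilon>) / (1 + \<gamma> * norm (v s) / \<epsilon>)"
      unfolding H_def using pos[of s] pos[of t] ln_diff_le[of "1 + \<gamma> * norm (v t) / \<epsilon>" "1 + \<gamma> * norm (v s) / \<epsilon>"] by simp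
    also have "\<dots> \<le> \<bar>\<gamma> * norm (v t) / \<epsilon> - \<gamma> * norm (v s) / \<epsilon>\<bar> / 1"
      using pos[of s] by (intro frac_le) auto
    also have "\<dots> = \<gamma> / \<epsilon> * \<bar>norm (v t) - norm (v s)\<bar>"
      using gamma eps by (simp flip: diff_divide_distrib right_diff_distrib add: abs_mult)
    also have "\<dots> \<le> \<gamma> / \<epsilon> * (K * \<bar>t - s\<bar>)"
      using norm_triangle_ineq3[of "v t" "v s"] K(2)[of s t] st T0 gamma eps
      by (intro mult_left_mono) auto
    finally show ?thesis by simp
  qed
  have "H ?T - H T0 \<le> integral {T0..?T} (\<lambda>_. - \<gamma>)"
  proof (rule lipschitz_increment_le_integral[OF \<open>T0 \<le> ?T\<close> _ _ _ N])
    show "0 \<le> \<gamma> / \<epsilon> * K" using gamma eps K by simp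
    show "\<bar>H t - H s\<bar> \<le> \<gamma> / \<epsilon> * K * \<bar>t - s\<bar>" if "s \<in> {T0..?T}" "t \<in> {T0..?T}" for s t
      using Hle[OF that] Hle[OF that(2,1)] by (simp add: abs_le_iff abs_minus_commute)
    show "(\<lambda>_. - \<gamma>) absolutely_integrable_on {T0..?T}"
      by (rule absolutely_integrable_continuous_real) simp
    fix t e :: real assume t: "t \<in> {T0<..<?T} - N" and "e > 0"
    have "norm (v ?T) \<le> norm (v t)" by (rule norm_v_decreasing) (use t in auto)
    then have vt: "v t \<noteq> 0" using nz by auto
    have tN: "t > 0" "t \<notin> N" "t \<ge> T0" using t T0 by auto
    let ?N' = "(v t \<bullet> v' t) / norm (v t)"
    let ?D = "\<gamma> * ?N' / \<epsilon> / (1 + \<gamma> * norm (v t) / \<epsilon>)"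
    note [derivative_intros] = norm_v_deriv[OF tN(1,2) vt]
    have "(H has_real_derivative ?D) (at t)"
      unfolding H_def[abs_def] using pos[of t] eps by (auto intro!: derivative_eq_intros simp: mult_ac)
    then obtain \<delta> where "\<delta> > 0" and
      \<delta>: "\<And>s. norm (s - t) < \<delta> \<Longrightarrow> norm (H s - H t - ?D * (s - t)) \<le> e * norm (s - t)"
      using \<open>e > 0\<close> unfolding has_field_derivative_def has_derivative_at_alt by blast
    \<comment> \<open>The bound \<open>- \<gamma> * norm (v t) - \<epsilon>\<close> on the
      derivative of the norm equals \<open>- \<epsilon>\<close> times the argument of the logarithm,
      which therefore cancels.\<close>
    have "?D \<le> - \<gamma>"
    proof -
      have "?N' \<le> - \<epsilon> * (1 + \<gamma> * norm (v t) / \<epsilon>)"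
        using norm_v_deriv_le[OF tN vt] eps by (simp add: distrib_left)
      then have "\<gamma> * ?N' / \<epsilon> \<le> \<gamma> * (- \<epsilon> * (1 + \<gamma> * norm (v t) / \<epsilon>)) / \<epsilon>"
        using gamma eps by (intro divide_right_mono mult_left_mono) auto
      also have "\<dots> = - \<gamma> * (1 + \<gamma> * norm (v t) / \<epsilon>)" using eps by simp
      finally show ?thesis using pos[of t] by (subst pos_divide_le_eq) linarith+
    qed
    have "\<forall>\<^sub>F h in at_right 0. h \<in> {0<..<\<delta>}"
      by (rule eventually_at_right_real) (rule \<open>\<delta> > 0\<close>)
    then show "\<forall>\<^sub>F h in at_right 0. H t - H (t - h) \<le> (- \<gamma> + e) * h"
    proof eventually_elim
      case (elim h)
      have "H t - H (t - h) \<le> ?D * h + e * h" using \<delta>[of "t - h"] elim by (simp add: abs_le_iff)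
      also have "\<dots> = (?D + e) * h" by (rule distrib_right[symmetric])
      also have "\<dots> \<le> (- \<gamma> + e) * h"
        using \<open>?D \<le> - \<gamma>\<close> elim by (intro mult_right_mono add_right_mono) auto
      finally show ?case .
    qed
  qed
  \<comment> \<open>By its definition \<open>stop_time\<close> exceeds \<open>T0\<close> by exactly
    \<open>H T0 / \<gamma>\<close>.\<close>
  also have "\<dots> = - H T0"
    using \<open>T0 \<le> ?T\<close> gamma by (simp add: stop_time_def H_def)
  finally have "H ?T \<le> 0" by simp
  moreover have "H ?T > 0" unfolding H_def using nz gamma eps by (intro ln_gt_zero) simp
  ultimately show False by simp
qed

lemma v_zero_after_stop_time:
  assumes "t \<ge> stop_time"
  shows "v t = 0"
proof -
  have "T0 \<le> stop_time" using gamma eps by (simp add: stop_time_def)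
  then show ?thesis using norm_v_decreasing[OF _ assms] v_stop_time by simp
qed

lemma T_stop_le: "T_stop v \<le> ereal stop_time"
proof -
  have "0 \<le> stop_time" using T0 gamma eps by (simp add: stop_time_def)
  then show ?thesis unfolding T_stop_def using v_zero_after_stop_time by (intro Inf_lower) auto
qed

end

end

section \<open>The finite-time stopping theorem\<close>

lemma weak_primitive_spike:
  assumes w: "weak_primitive a b w w' (\<lambda>t. norm (w' t))" and N: "negligible N"
    and eq: "\<And>t. t \<in> {a..b} - N \<Longrightarrow> z' t = w' t"
  shows "weak_primitive a b w z' (\<lambda>t. norm (z' t))"
  unfolding weak_primitive_def
proof (intro conjI allI impI ballI order_refl)
  fix m s t assume st: "a \<le> s" "s \<le> t" "t \<le> b"
  show "((\<lambda>\<tau>. m \<bullet> z' \<tau>) has_integral m \<bullet> (w t - w s)) {s..t}"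
    by (rule has_integral_spike[OF N _ weak_primitiveD(1)[OF w st]]) (use eq st in auto)
next
  show "(\<lambda>t. norm (z' t)) integrable_on {a..b}"
    by (rule integrable_spike[OF weak_primitiveD(2)[OF w] N]) (use eq in auto)
qed

text \<open>The pointwise derivative \<open>D\<close> of \<open>v\<close> does not depend on the
  horizon and agrees almost everywhere with the weak derivative supplied for each \<open>T\<close>.
  Horizons \<open>1, 2, 3, ...\<close> cover the half line, so a countable union of null sets serves
  all of them.\<close>

lemma global_strong_solution_friction_flow:
  fixes \<phi> :: "'a::real_inner \<Rightarrow> ereal"
  assumes "\<gamma> > 0" "\<beta> \<ge> 0" and G: "\<And>B. bounded B \<Longrightarrow> \<exists>L. L-lipschitz_on B G"
    and "\<phi> 0 = 0" "\<And>y. 0 \<le> \<phi> y" "lsc_fun \<phi>" "v\<^sub>0 \<in> Dom_subdiff \<phi>"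
    and sol: "global_strong_solution \<phi> G \<gamma> \<beta> x\<^sub>0 v\<^sub>0 x v"
  obtains v' N where "friction_flow \<phi> G \<gamma> \<beta> x v v' N"
proof -
  define D where "D t = vector_derivative v (at t)" for t
  have *: "\<exists>N. negligible N \<and> weak_primitive 0 (T) x v (\<lambda>t. norm (v t)) \<and>
      weak_primitive 0 (T) v D (\<lambda>t. norm (D t)) \<and>
      (\<lambda>t. (norm (D t))\<^sup>2) integrable_on {0..T} \<and>
      (\<forall>t\<in>{0<..<T} - N. (x has_vector_derivative v t) (at t) \<and> (v has_vector_derivative D t) (at t) \<and>
         - (D t + \<gamma> *\<^sub>R v t + G (x t + \<beta> *\<^sub>R v t)) \<in> subdiff \<phi> (v t))" if "T > 0" for T
  proof -
    have "strong_solution \<phi> G \<gamma> \<beta> x\<^sub>0 v\<^sub>0 T x v"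
      using sol that by (simp add: global_strong_solution_def)
    then obtain x' u \<xi> where x: "W12_deriv T x x'" and v: "W12_deriv T v u"
      and xv: "AE t in lebesgue_on {0<..<T}. v t = x' t"
      and incl: "AE t in lebesgue_on {0<..<T}. \<xi> t \<in> subdiff \<phi> (v t) \<and>
           u t + \<gamma> *\<^sub>R v t + \<xi> t + G (x t + \<beta> *\<^sub>R v t) = 0"
      unfolding strong_solution_def by blast
    obtain N1 where N1: "negligible N1" "\<And>t. t \<in> {0<..<T} - N1 \<Longrightarrow> (x has_vector_derivative x' t) (at t)"
      using W12_has_vector_derivative[OF x] by blast
    obtain N2 where N2: "negligible N2" "\<And>t. t \<in> {0<..<T} - N2 \<Longrightarrow> (v has_vector_derivative u t) (at t)"
      using W12_has_vector_derivative[OF v] by blast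
    obtain N3 where N3: "negligible N3" "\<forall>t\<in>{0<..<T} - N3. v t = x' t"
      using AE_lebesgue_on_iff_negligible[of "{0<..<T}", THEN iffD1, OF _ xv] by auto
    obtain N4 where N4: "negligible N4" "\<forall>t\<in>{0<..<T} - N4. \<xi> t \<in> subdiff \<phi> (v t) \<and>
           u t + \<gamma> *\<^sub>R v t + \<xi> t + G (x t + \<beta> *\<^sub>R v t) = 0"
      using AE_lebesgue_on_iff_negligible[of "{0<..<T}", THEN iffD1, OF _ incl] by auto
    \<comment> \<open>The end points are added because the primitives live on the closed interval
      while the differentiability facts hold in its interior.\<close>
    let ?N = "N1 \<union> N2 \<union> N3 \<union> N4 \<union> {0, T}"
    have N: "negligible ?N" using N1 N2 N3 N4 by simp
    have Du: "D t = u t" if "t \<in> {0..T} - ?N" for t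
      using N2(2)[of t] that by (auto simp: D_def intro: vector_derivative_at)
    have "weak_primitive 0 T x v (\<lambda>t. norm (v t))"
      by (rule weak_primitive_spike[OF W12_weak_primitive[OF x] N]) (use N3 in auto)
    moreover have "weak_primitive 0 T v D (\<lambda>t. norm (D t))"
      by (rule weak_primitive_spike[OF W12_weak_primitive[OF v] N Du])
    moreover have "(\<lambda>t. (norm (D t))\<^sup>2) integrable_on {0..T}"
    proof (rule integrable_spike[OF _ N])
      show "(\<lambda>t. (norm (u t))\<^sup>2) integrable_on {0..T}"
        using v by (intro L2_fun_integrable_on) (simp add: W12_deriv_def)
    qed (simp add: Du)
    moreover have "(x has_vector_derivative v t) (at t) \<and> (v has_vector_derivative D t) (at t) \<and>
         - (D t + \<gamma> *\<^sub>R v t + G (x t + \<beta> *\<^sub>R v t)) \<in> subdiff \<phi> (v t)"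
      if t: "t \<in> {0<..<T} - ?N" for t
    proof -
      have "u t + \<gamma> *\<^sub>R v t + \<xi> t + G (x t + \<beta> *\<^sub>R v t) = 0" "\<xi> t \<in> subdiff \<phi> (v t)" using N4 t by auto
      moreover from this(1) have "\<xi> t = - (u t + \<gamma> *\<^sub>R v t + G (x t + \<beta> *\<^sub>R v t))"
        by (metis add.assoc add.commute add_eq_0_iff)
      moreover have "D t = u t" using t by (intro Du) auto
      ultimately show ?thesis using N1(2)[of t] N2(2)[of t] N3(2) t by auto
    qed
    ultimately show ?thesis using N by blast
  qed
  have "\<forall>n. \<exists>N. negligible N \<and> weak_primitive 0 (real (Suc n)) x v (\<lambda>t. norm (v t)) \<and>
      weak_primitive 0 (real (Suc n)) v D (\<lambda>t. norm (D t)) \<and>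
      (\<lambda>t. (norm (D t))\<^sup>2) integrable_on {0..real (Suc n)} \<and>
      (\<forall>t\<in>{0<..<real (Suc n)} - N. (x has_vector_derivative v t) (at t) \<and> (v has_vector_derivative D t) (at t) \<and>
         - (D t + \<gamma> *\<^sub>R v t + G (x t + \<beta> *\<^sub>R v t)) \<in> subdiff \<phi> (v t))"
    by (intro allI *) simp
  from choice[OF this] obtain N where N: "\<And>n. negligible (N n)"
    and wx: "\<And>n. weak_primitive 0 (real (Suc n)) x v (\<lambda>t. norm (v t))"
    and wv: "\<And>n. weak_primitive 0 (real (Suc n)) v D (\<lambda>t. norm (D t))"
    and sq: "\<And>n. (\<lambda>t. (norm (D t))\<^sup>2) integrable_on {0..real (Suc n)}"
    and der: "\<And>n t. t \<in> {0<..<real (Suc n)} - N n \<Longrightarrow>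
      (x has_vector_derivative v t) (at t) \<and> (v has_vector_derivative D t) (at t) \<and>
      - (D t + \<gamma> *\<^sub>R v t + G (x t + \<beta> *\<^sub>R v t)) \<in> subdiff \<phi> (v t)"
    by blast
  have ex: "\<exists>n. T < real (Suc n)" for T
    using reals_Archimedean2[of T] by (metis less_SucI of_nat_less_iff order_less_trans lessI)
  have v0: "v 0 = v\<^sub>0"
    using sol by (auto simp: global_strong_solution_def strong_solution_def intro: zero_less_one)
  have "friction_flow \<phi> G \<gamma> \<beta> x v D (\<Union>n. N n)"
  proof
    show "v 0 \<in> Dom_subdiff \<phi>" using v0 assms(7) by simp
    show "negligible (\<Union>n. N n)" using N by (rule negligible_Union_nat)
    fix T :: real
    obtain n where n: "T < real (Suc n)" using ex by blast
    show "weak_primitive 0 T x v (\<lambda>t. norm (v t))"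
      by (rule weak_primitive_subinterval[OF wx[of n]]) (use n in auto)
    show "weak_primitive 0 T v D (\<lambda>t. norm (D t))"
      by (rule weak_primitive_subinterval[OF wv[of n]]) (use n in auto)
    show "(\<lambda>t. (norm (D t))\<^sup>2) integrable_on {0..T}"
      by (rule integrable_on_subinterval[OF sq[of n]]) (use n in auto)
    assume "T > 0" "T \<notin> (\<Union>n. N n)"
    then have "T \<in> {0<..<real (Suc n)} - N n" using n by auto
    from der[OF this]
    show "(x has_vector_derivative v T) (at T)" "(v has_vector_derivative D T) (at T)"
      "- (D T + \<gamma> *\<^sub>R v T + G (x T + \<beta> *\<^sub>R v T)) \<in> subdiff \<phi> (v T)" by auto
  qed (use assms in auto)
  then show thesis by (rule that)
qed

theorem theorem2p12:
  fixes f :: "'a::{real_inner, complete_space} \<Rightarrow> real"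
    and gradf :: "'a \<Rightarrow> 'a"
    and \<phi> :: "'a \<Rightarrow> ereal"
    and \<gamma> \<beta> r :: real
    and x\<^sub>0 v\<^sub>0 :: 'a
    and x v q :: "real \<Rightarrow> 'a"
  assumes "\<gamma> > 0" and "\<beta> \<ge> 0"
    and "\<And>y. GDERIV f y :> gradf y"
    and "continuous_on UNIV gradf"
    and "\<And>B. bounded B \<Longrightarrow> \<exists>L. L-lipschitz_on B gradf"
    and "bdd_below (range f)"
    and "proper_fun \<phi>" and "lsc_fun \<phi>" and "convex_fun \<phi>"
    and "\<phi> 0 = 0" and "\<And>y. 0 \<le> \<phi> y"
    and "r > 0" and "cball 0 r \<subseteq> subdiff \<phi> 0"
    and "v\<^sub>0 \<in> Dom_subdiff \<phi>"
    and "global_strong_solution \<phi> gradf \<gamma> \<beta> x\<^sub>0 v\<^sub>0 x v"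
    and "q = (\<lambda>t. - gradf (x t + \<beta> *\<^sub>R v t))"
  shows
    "(\<forall>T\<^sub>0 \<epsilon>. T\<^sub>0 \<ge> 0 \<longrightarrow> \<epsilon> > 0 \<longrightarrow> (\<forall>t\<ge>T\<^sub>0. cball (q t) \<epsilon> \<subseteq> subdiff \<phi> 0) \<longrightarrow>
        T_stop v < \<infinity> \<and>
        (AE t in lebesgue. t \<ge> T\<^sub>0 \<longrightarrow> v t \<noteq> 0 \<longrightarrow>
           (\<exists>D. ((\<lambda>s. norm (v s)) has_real_derivative D) (at t) \<and>
                D + \<gamma> * norm (v t) + \<epsilon> \<le> 0)) \<and>
        T_stop v \<le> ereal (T\<^sub>0 + 1 / \<gamma> * ln (1 + \<gamma> * norm (v T\<^sub>0) / \<epsilon>)))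
     \<and> (\<forall>xinf. (x \<longlongrightarrow> xinf) at_top \<longrightarrow> - gradf xinf \<in> interior (subdiff \<phi> 0) \<longrightarrow>
        T_stop v < \<infinity>)"
proof -
  obtain v' N where "friction_flow \<phi> gradf \<gamma> \<beta> x v v' N"
    using global_strong_solution_friction_flow[OF assms(1,2,5,10,11,8,14,15)] by blast
  then interpret friction_flow \<phi> gradf \<gamma> \<beta> x v v' N .
  have q: "q t = - gradf (y t)" for t by (simp add: assms(16) y_def)
  have a: "T_stop v \<le> ereal (T\<^sub>0 + 1 / \<gamma> * ln (1 + \<gamma> * norm (v T\<^sub>0) / \<epsilon>)) \<and>
      (AE t in lebesgue. t \<ge> T\<^sub>0 \<longrightarrow> v t \<noteq> 0 \<longrightarrow>
           (\<exists>D. ((\<lambda>s. norm (v s)) has_real_derivative D) (at t) \<and>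
                D + \<gamma> * norm (v t) + \<epsilon> \<le> 0))"
    if T0: "T\<^sub>0 \<ge> 0" "\<epsilon> > 0" and ball: "\<And>t. t \<ge> T\<^sub>0 \<Longrightarrow> cball (q t) \<epsilon> \<subseteq> subdiff \<phi> 0" for T\<^sub>0 \<epsilon>
  proof
    have ball': "cball (- gradf (y t)) \<epsilon> \<subseteq> subdiff \<phi> 0" if "t \<ge> T\<^sub>0" for t
      using ball[OF that] by (simp add: q)
    show "T_stop v \<le> ereal (T\<^sub>0 + 1 / \<gamma> * ln (1 + \<gamma> * norm (v T\<^sub>0) / \<epsilon>))"
      using T_stop_le[OF T0 ball'] stop_time_def[OF T0 ball'] by simp
    show "AE t in lebesgue. t \<ge> T\<^sub>0 \<longrightarrow> v t \<noteq> 0 \<longrightarrow>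
           (\<exists>D. ((\<lambda>s. norm (v s)) has_real_derivative D) (at t) \<and>
                D + \<gamma> * norm (v t) + \<epsilon> \<le> 0)"
      unfolding eventually_ae_filter_negligible
    proof (intro exI conjI subsetI)
      \<comment> \<open>The derivative facts concern positive times only, and
        \<open>T\<^sub>0\<close> may be \<open>0\<close>.\<close>
      show "negligible (N \<union> {0})" using N by simp
      fix t assume t: "t \<in> {t. \<not> (t \<ge> T\<^sub>0 \<longrightarrow> v t \<noteq> 0 \<longrightarrow>
           (\<exists>D. ((\<lambda>s. norm (v s)) has_real_derivative D) (at t) \<and>
                D + \<gamma> * norm (v t) + \<epsilon> \<le> 0))}"
      show "t \<in> N \<union> {0}"
      proof (rule ccontr)
        assume "t \<notin> N \<union> {0}"
        then have "t > 0" "t \<notin> N" "t \<ge> T\<^sub>0" "v t \<noteq> 0" using t T0 by auto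
        then show False
          using t norm_v_deriv[of t] norm_v_deriv_le[OF T0 ball', of t] by blast
      qed
    qed
  qed
  have b: "T_stop v < \<infinity>"
    if lim: "(x \<longlongrightarrow> xinf) at_top" and int: "- gradf xinf \<in> interior (subdiff \<phi> 0)" for xinf
  proof -
    obtain e where "e > 0" and e: "cball (- gradf xinf) e \<subseteq> subdiff \<phi> 0"
      using int by (auto simp: mem_interior_cball)
    have "((\<lambda>t. \<beta> *\<^sub>R v t) \<longlongrightarrow> 0) at_top"
    proof (cases "\<beta> = 0")
      case False
      then have "(v \<longlongrightarrow> 0) at_top" using assms(2) by (intro v_tendsto_zero[OF assms(3,6)]) auto
      from tendsto_scaleR[OF tendsto_const this] show ?thesis by simp
    qed simp
    from tendsto_add[OF lim this] have "(y \<longlongrightarrow> xinf) at_top" by (simp add: y_def[abs_def])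
    moreover have "isCont gradf xinf" using assms(4) by (simp add: continuous_on_eq_continuous_at)
    ultimately have "((\<lambda>t. gradf (y t)) \<longlongrightarrow> gradf xinf) at_top" by (rule isCont_tendsto_compose[rotated])
    then have "\<forall>\<^sub>F t in at_top. dist (gradf (y t)) (gradf xinf) < e / 2"
      using \<open>e > 0\<close> by (intro tendstoD) auto
    then obtain T1 where T1: "\<And>t. t \<ge> T1 \<Longrightarrow> dist (gradf (y t)) (gradf xinf) < e / 2"
      unfolding eventually_at_top_linorder by blast
    \<comment> \<open>Half of the radius \<open>e\<close> absorbs the distance from
      \<open>q t\<close> to its limit; the other half remains as the margin for the first
      part.\<close>
    have "cball (q t) (e / 2) \<subseteq> subdiff \<phi> 0" if "t \<ge> max 0 T1" for t
    proof -
      have "dist (- gradf xinf) (q t) < e / 2" using T1[of t] that by (simp add: q dist_minus dist_commute)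
      have "z \<in> cball (- gradf xinf) e" if "z \<in> cball (q t) (e / 2)" for z
        using dist_triangle[of "- gradf xinf" z "q t"] \<open>dist (- gradf xinf) (q t) < e / 2\<close> that by auto
      then show ?thesis using e by blast
    qed
    then have "T_stop v \<le> ereal (max 0 T1 + 1 / \<gamma> * ln (1 + \<gamma> * norm (v (max 0 T1)) / (e / 2)))"
      using a[of "max 0 T1" "e / 2"] \<open>e > 0\<close> by auto
    also have "\<dots> < \<infinity>" by simp
    finally show ?thesis .
  qed
  show ?thesis
  proof (intro conjI allI impI)
    fix T\<^sub>0 \<epsilon> :: real
    assume "0 \<le> T\<^sub>0" "0 < \<epsilon>" "\<forall>t\<ge>T\<^sub>0. cball (q t) \<epsilon> \<subseteq> subdiff \<phi> 0"
    then have A: "T_stop v \<le> ereal (T\<^sub>0 + 1 / \<gamma> * ln (1 + \<gamma> * norm (v T\<^sub>0) / \<epsilon>)) \<and>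
      (AE t in lebesgue. t \<ge> T\<^sub>0 \<longrightarrow> v t \<noteq> 0 \<longrightarrow>
           (\<exists>D. ((\<lambda>s. norm (v s)) has_real_derivative D) (at t) \<and>
                D + \<gamma> * norm (v t) + \<epsilon> \<le> 0))"
      by (intro a) auto
    then show "T_stop v \<le> ereal (T\<^sub>0 + 1 / \<gamma> * ln (1 + \<gamma> * norm (v T\<^sub>0) / \<epsilon>))" ..
    then show "T_stop v < \<infinity>" by (rule order_le_less_trans) simp
    show "AE t in lebesgue. t \<ge> T\<^sub>0 \<longrightarrow> v t \<noteq> 0 \<longrightarrow>
           (\<exists>D. ((\<lambda>s. norm (v s)) has_real_derivative D) (at t) \<and>
                D + \<gamma> * norm (v t) + \<epsilon> \<le> 0)" using A ..
  qed (rule b)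
qed

end
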